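(* Let $G$ be a discrete group acting by $*$-automorphisms $\alpha_g$, $g\in G$, on a finite von Neumann algebra $\mathcal{M}\subseteq B(\mathcal{H})$ with a faithful normal $G$-invariant tracial state $\tau$. Equip $\mathcal{M}\rtimes_\alpha G$ with its canonical faithful normal tracial state $\tilde\tau$ induced by $\tau$. If $H$ and $K$ are two distinct subgroups of $G$, then $$d_{MT}(\mathcal{M}\rtimes_\alpha H,\ \mathcal{M}\rtimes_\alpha K)=1.$$
   Context: Crossed product. On $\tilde{\mathcal{H}}=\ell^2(G,\mathcal{H})$ define, for $a\in\mathcal{M}$, $g,h\in G$, $\xi\in\tilde{\mathcal{H}}$, $$(\pi(a)\xi)(g)=\alpha_{g^{-1}}(a)\xi(g),\qquad (\lambda(g)\xi)(h)=\xi(g^{-1}h).$$ $\mathcal{M}\rtimes_\alpha G$ is the von Neumann algebra generated by $\pi(\mathcal{M})$ and $\lambda(G)$ in $B(\tilde{\mathcal{H}})$. For a subgroup $H\le G$, $\mathcal{M}\rtimes_\alpha H$ denotes the von Neumann subalgebra of $\mathcal{M}\rtimes_\alpha G$ generated by $\pi(\mathcal{M})$ and $\lambda(H)$. Trace. $\tau$ is $G$-invariant if $\tau(\alpha_g(x))=\tau(x)$ for all $g\in G$, $x\in\mathcal{M}$. Let $P_e:\tilde{\mathcal{H}}\to\mathcal{H}$, $P_e\xi=\xi(e)$, and $E(z)=P_ezP_e^*$, which maps $\mathcal{M}\rtimes_\alpha G$ onto $\mathcal{M}$; the tracial state on $\mathcal{M}\rtimes_\alpha G$ is $\tilde\tau(z)=\tau(E(z))$.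 Mashood-Taylor distance. Let $\mathcal{N}$ be a von Neumann algebra with a faithful normal tracial state $\tau_0$, let $\|x\|_{\tau_0}=\tau_0(x^*x)^{1/2}$, and let $\widehat{x}$ denote $x\in\mathcal{N}$ viewed as an element of $L^2(\mathcal{N},\tau_0)$. For subalgebras $\mathcal{P},\mathcal{Q}$ of $\mathcal{N}$, with $B_1(\cdot)$ denoting the closed unit ball in the operator norm, $d_{MT}(\mathcal{P},\mathcal{Q})$ is the Hausdorff distance, with respect to the metric induced by $\|\cdot\|_{\tau_0}$, between $\{\widehat{x} : x\in B_1(\mathcal{P})\}$ and $\{\widehat{x} : x\in B_1(\mathcal{Q})\}$. Here it is used with $\mathcal{N}=\mathcal{M}\rtimes_\alpha G$ and $\tau_0=\tilde\tau$. *)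

theory Defs
  imports "HOL-Analysis.Analysis"
begin

section \<open>Complex Hilbert spaces\<close>

text \<open>
  A complex inner product is stored together with the real inner product \<^term>\<open>inner\<close> that is its
  real part, so that norm, topology and bounded operators are those of HOL-Analysis.
  The complex inner product is linear in its first argument.
\<close>

class complex_inner = real_inner +
  fixes scaleC :: "complex \<Rightarrow> 'a \<Rightarrow> 'a" (infixr "*\<^sub>C" 75)
    and cinner :: "'a \<Rightarrow> 'a \<Rightarrow> complex"
  assumes scaleC_add_right: "c *\<^sub>C (x + y) = c *\<^sub>C x + c *\<^sub>C y"
    and scaleC_add_left: "(c + d) *\<^sub>C x = c *\<^sub>C x + d *\<^sub>C x"
    and scaleC_scaleC: "c *\<^sub>C (d *\<^sub>C x) = (c * d) *\<^sub>C x"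
    and scaleR_scaleC: "scaleR r x = complex_of_real r *\<^sub>C x"
    and cinner_commute: "cinner x y = cnj (cinner y x)"
    and cinner_add_left: "cinner (x + y) z = cinner x z + cinner y z"
    and cinner_scaleC_left: "cinner (c *\<^sub>C x) y = c * cinner x y"
    and inner_eq_Re_cinner: "inner x y = Re (cinner x y)"

class chilbert_space = complex_inner + complete_space

context complex_inner
begin

lemma cinner_add_right: "cinner x (y + z) = cinner x y + cinner x z"
  by (subst (1 2 3) cinner_commute) (simp add: cinner_add_left)

lemma cinner_scaleC_right: "cinner x (c *\<^sub>C y) = cnj c * cinner x y"
  by (subst (1 2) cinner_commute) (simp add: cinner_scaleC_left)

lemma Im_cinner: "Im (cinner x y) = inner x (\<i> *\<^sub>C y)"
  by (simp add: inner_eq_Re_cinner cinner_scaleC_right)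

lemma cinner_eq_inner: "cinner x y = Complex (inner x y) (inner x (\<i> *\<^sub>C y))"
  by (simp add: complex_eq_iff inner_eq_Re_cinner cinner_scaleC_right)

lemma cinner_self: "cinner x x = complex_of_real (inner x x)"
proof -
  have "Im (cinner x x) = 0"
    using cinner_commute[of x x] by (simp add: complex_eq_iff)
  then show ?thesis by (simp add: complex_eq_iff inner_eq_Re_cinner)
qed

end

lemma norm_scaleC: "norm (c *\<^sub>C (x::'a::complex_inner)) = cmod c * norm x"
proof -
  have "inner (c *\<^sub>C x) (c *\<^sub>C x) = (cmod c)\<^sup>2 * inner x x"
  proof -
    have "cinner (c *\<^sub>C x) (c *\<^sub>C x) = (c * cnj c) * cinner x x"
      by (simp add: cinner_scaleC_left cinner_scaleC_right mult.assoc)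
    then show ?thesis
      by (simp add: cinner_self complex_norm_square[symmetric] flip: of_real_power of_real_mult)
  qed
  then show ?thesis
    by (simp add: norm_eq_sqrt_inner real_sqrt_mult)
qed

lemma bounded_linear_scaleC: "bounded_linear (\<lambda>x::'a::complex_inner. c *\<^sub>C x)"
proof (rule bounded_linear_intro[where K = "cmod c"])
  fix x y :: 'a and r :: real
  show "c *\<^sub>C (x + y) = c *\<^sub>C x + c *\<^sub>C y" by (rule scaleC_add_right)
  show "c *\<^sub>C r *\<^sub>R x = r *\<^sub>R c *\<^sub>C x" by (simp add: scaleR_scaleC scaleC_scaleC mult.commute)
  show "norm (c *\<^sub>C x) \<le> norm x * cmod c" by (simp add: norm_scaleC mult.commute)
qed


section \<open>The Hilbert space of square-summable families\<close>

typedef (overloaded) ('g, 'h::chilbert_space) ell2 =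
  "{\<xi> :: 'g \<Rightarrow> 'h. (\<lambda>g. (norm (\<xi> g))\<^sup>2) summable_on UNIV}"
  morphisms ell2_apply Abs_ell2
  by (rule exI[of _ "\<lambda>_. 0"]) simp

setup_lifting type_definition_ell2

lemma ell2_summable: "(\<lambda>g. (norm (ell2_apply \<xi> g))\<^sup>2) summable_on UNIV"
  using ell2_apply[of \<xi>] by simp

lemma ell2_eqI: "(\<And>g. ell2_apply \<xi> g = ell2_apply \<eta> g) \<Longrightarrow> \<xi> = \<eta>"
  by (simp add: ell2_apply_inject[symmetric] fun_eq_iff)

lemma norm_inner_le_squares: "\<bar>inner x y\<bar> \<le> (norm x)\<^sup>2 + (norm (y::'a::real_inner))\<^sup>2"
proof -
  have *: "a * b \<le> a\<^sup>2 + b\<^sup>2" if "0 \<le> a" "0 \<le> b" for a b :: real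
  proof -
    have "0 \<le> a * b" using that by simp
    moreover have "2 * (a * b) \<le> a\<^sup>2 + b\<^sup>2"
      using sum_squares_bound[of a b] by (simp only: mult.assoc)
    ultimately show ?thesis by linarith
  qed
  have "\<bar>inner x y\<bar> \<le> norm x * norm y" by (rule Cauchy_Schwarz_ineq2)
  also have "\<dots> \<le> (norm x)\<^sup>2 + (norm y)\<^sup>2" by (rule *) simp_all
  finally show ?thesis .
qed

lemma ell2_inner_summable:
  "(\<lambda>g. inner (ell2_apply \<xi> g) (ell2_apply \<eta> g)) summable_on UNIV"
proof -
  have "(\<lambda>g. \<bar>inner (ell2_apply \<xi> g) (ell2_apply \<eta> g)\<bar>) summable_on UNIV"
    by (rule summable_on_comparison_test[OF summable_on_add[OF ell2_summable[of \<xi>] ell2_summable[of \<eta>]]])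
      (auto simp: norm_inner_le_squares)
  then show ?thesis
    by (subst summable_on_iff_abs_summable_on_real) simp
qed

lemma ell2_cinner_summable:
  "(\<lambda>g. cinner (ell2_apply \<xi> g) (ell2_apply \<eta> g)) summable_on UNIV"
proof -
  have scale: "(\<lambda>g. (norm (\<i> *\<^sub>C ell2_apply \<eta> g))\<^sup>2) summable_on UNIV"
    using ell2_summable[of \<eta>] by (simp add: norm_scaleC)
  have "(\<lambda>g. complex_of_real (inner (ell2_apply \<xi> g) (ell2_apply \<eta> g))
      + \<i> * complex_of_real (inner (ell2_apply \<xi> g) (ell2_apply (Abs_ell2 (\<lambda>g. \<i> *\<^sub>C ell2_apply \<eta> g)) g)))
      summable_on UNIV"
    by (intro summable_on_add summable_on_cmult_right summable_on_of_real ell2_inner_summable)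
  then show ?thesis
    using scale by (simp add: Abs_ell2_inverse cinner_eq_inner Complex_eq)
qed

instantiation ell2 :: (type, chilbert_space) complex_inner
begin

lift_definition zero_ell2 :: "('a, 'b) ell2" is "\<lambda>_. 0"
  by simp

lift_definition uminus_ell2 :: "('a, 'b) ell2 \<Rightarrow> ('a, 'b) ell2" is "\<lambda>\<xi> g. - \<xi> g"
  by simp

lift_definition plus_ell2 :: "('a, 'b) ell2 \<Rightarrow> ('a, 'b) ell2 \<Rightarrow> ('a, 'b) ell2"
  is "\<lambda>\<xi> \<eta> g. \<xi> g + \<eta> g"
proof -
  fix \<xi> \<eta> :: "'a \<Rightarrow> 'b"
  assume "(\<lambda>g. (norm (\<xi> g))\<^sup>2) summable_on UNIV" "(\<lambda>g. (norm (\<eta> g))\<^sup>2) summable_on UNIV"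
  then have "(\<lambda>g. 2 * ((norm (\<xi> g))\<^sup>2 + (norm (\<eta> g))\<^sup>2)) summable_on UNIV"
    by (intro summable_on_cmult_right summable_on_add)
  moreover have "(norm (x + y))\<^sup>2 \<le> 2 * ((norm x)\<^sup>2 + (norm y)\<^sup>2)" for x y :: 'b
  proof -
    have "(norm (x + y))\<^sup>2 \<le> (norm x + norm y)\<^sup>2"
      by (intro power_mono norm_triangle_ineq) auto
    also have "\<dots> \<le> 2 * ((norm x)\<^sup>2 + (norm y)\<^sup>2)"
      using sum_squares_bound[of "norm x" "norm y"] by (simp add: power2_sum)
    finally show ?thesis .
  qed
  ultimately show "(\<lambda>g. (norm (\<xi> g + \<eta> g))\<^sup>2) summable_on UNIV"
    by (rule summable_on_comparison_test) auto
qed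

definition "minus_ell2 \<xi> \<eta> = \<xi> + - (\<eta> :: ('a, 'b) ell2)"

lift_definition scaleC_ell2 :: "complex \<Rightarrow> ('a, 'b) ell2 \<Rightarrow> ('a, 'b) ell2"
  is "\<lambda>c \<xi> g. c *\<^sub>C \<xi> g"
  by (auto simp: norm_scaleC power_mult_distrib intro: summable_on_cmult_right)

lift_definition scaleR_ell2 :: "real \<Rightarrow> ('a, 'b) ell2 \<Rightarrow> ('a, 'b) ell2"
  is "\<lambda>r \<xi> g. r *\<^sub>R \<xi> g"
  by (auto simp: power_mult_distrib intro: summable_on_cmult_right)

definition cinner_ell2 :: "('a, 'b) ell2 \<Rightarrow> ('a, 'b) ell2 \<Rightarrow> complex" where
  "cinner_ell2 \<xi> \<eta> = (\<Sum>\<^sub>\<infinity>g. cinner (ell2_apply \<xi> g) (ell2_apply \<eta> g))"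

definition inner_ell2 :: "('a, 'b) ell2 \<Rightarrow> ('a, 'b) ell2 \<Rightarrow> real" where
  "inner_ell2 \<xi> \<eta> = (\<Sum>\<^sub>\<infinity>g. inner (ell2_apply \<xi> g) (ell2_apply \<eta> g))"

definition norm_ell2 :: "('a, 'b) ell2 \<Rightarrow> real" where
  "norm_ell2 \<xi> = sqrt (inner \<xi> \<xi>)"

definition sgn_ell2 :: "('a, 'b) ell2 \<Rightarrow> ('a, 'b) ell2" where
  "sgn_ell2 \<xi> = inverse (norm \<xi>) *\<^sub>R \<xi>"

definition dist_ell2 :: "('a, 'b) ell2 \<Rightarrow> ('a, 'b) ell2 \<Rightarrow> real" where
  "dist_ell2 \<xi> \<eta> = norm (\<xi> - \<eta>)"

definition uniformity_ell2 :: "(('a, 'b) ell2 \<times> ('a, 'b) ell2) filter" where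
  "uniformity_ell2 = (INF e\<in>{0<..}. principal {(x, y). dist x y < e})"

definition open_ell2 :: "('a, 'b) ell2 set \<Rightarrow> bool" where
  "open_ell2 U = (\<forall>x\<in>U. \<forall>\<^sub>F (x', y) in uniformity. x' = x \<longrightarrow> y \<in> U)"

instance
proof
  fix x y z :: "('a, 'b) ell2" and r s :: real and c d :: complex
  show "x + y + z = x + (y + z)" by transfer (simp add: add.assoc)
  show "x + y = y + x" by transfer (simp add: add.commute)
  show "0 + x = x" by transfer simp
  show "- x + x = 0" by transfer simp
  show "x - y = x + - y" by (rule minus_ell2_def)
  show "r *\<^sub>R (x + y) = r *\<^sub>R x + r *\<^sub>R y" by transfer (simp add: scaleR_add_right)
  show "(r + s) *\<^sub>R x = r *\<^sub>R x + s *\<^sub>R x" by transfer (simp add: scaleR_add_left)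
  show "r *\<^sub>R s *\<^sub>R x = (r * s) *\<^sub>R x" by transfer simp
  show "1 *\<^sub>R x = x" by transfer simp
  show "sgn x = inverse (norm x) *\<^sub>R x" by (rule sgn_ell2_def)
  show "dist x y = norm (x - y)" by (rule dist_ell2_def)
  show "uniformity = (INF e\<in>{0<..}. principal {(x :: ('a, 'b) ell2, y). dist x y < e})"
    by (rule uniformity_ell2_def)
  show "open U = (\<forall>x\<in>U. \<forall>\<^sub>F (x', y) in uniformity. x' = x \<longrightarrow> y \<in> U)"
    for U :: "('a, 'b) ell2 set"
    by (rule open_ell2_def)
  show "inner x y = inner y x" by (simp add: inner_ell2_def inner_commute)
  show "inner (x + y) z = inner x z + inner y z"
    by (simp add: inner_ell2_def plus_ell2.rep_eq inner_add_left infsum_add ell2_inner_summable)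
  show "inner (r *\<^sub>R x) y = r * inner x y"
    by (simp add: inner_ell2_def scaleR_ell2.rep_eq infsum_cmult_right')
  show "0 \<le> inner x x" by (simp add: inner_ell2_def infsum_nonneg)
  show "inner x x = 0 \<longleftrightarrow> x = 0"
  proof
    assume "inner x x = 0"
    then have "inner (ell2_apply x g) (ell2_apply x g) = 0" for g
      unfolding inner_ell2_def
      by (intro nonneg_infsum_le_0D[OF _ ell2_inner_summable[of x x], where x = g]) auto
    then show "x = 0" by (intro ell2_eqI) (simp add: zero_ell2.rep_eq)
  qed (simp add: inner_ell2_def zero_ell2.rep_eq)
  show "norm x = sqrt (inner x x)" by (rule norm_ell2_def)
  show "c *\<^sub>C (x + y) = c *\<^sub>C x + c *\<^sub>C y" by transfer (simp add: scaleC_add_right)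
  show "(c + d) *\<^sub>C x = c *\<^sub>C x + d *\<^sub>C x" by transfer (simp add: scaleC_add_left)
  show "c *\<^sub>C d *\<^sub>C x = (c * d) *\<^sub>C x" by transfer (simp add: scaleC_scaleC)
  show "r *\<^sub>R x = complex_of_real r *\<^sub>C x" by transfer (simp add: scaleR_scaleC)
  show "cinner x y = cnj (cinner y x)"
    unfolding cinner_ell2_def by (subst cinner_commute) (rule infsum_cnj)
  show "cinner (x + y) z = cinner x z + cinner y z"
    by (simp add: cinner_ell2_def plus_ell2.rep_eq cinner_add_left infsum_add ell2_cinner_summable)
  show "cinner (c *\<^sub>C x) y = c * cinner x y"
    by (simp add: cinner_ell2_def scaleC_ell2.rep_eq cinner_scaleC_left infsum_cmult_right')
  show "inner x y = Re (cinner x y)"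
    by (simp add: inner_ell2_def cinner_ell2_def infsum_Re ell2_cinner_summable inner_eq_Re_cinner)
qed

end

lemma ell2_norm_square: "(norm \<xi>)\<^sup>2 = (\<Sum>\<^sub>\<infinity>g. (norm (ell2_apply \<xi> g))\<^sup>2)"
  by (simp only: power2_norm_eq_inner inner_ell2_def)

lemma ell2_sum_le_norm:
  "finite F \<Longrightarrow> (\<Sum>g\<in>F. (norm (ell2_apply \<xi> g))\<^sup>2) \<le> (norm \<xi>)\<^sup>2"
  unfolding ell2_norm_square by (rule finite_sum_le_infsum[OF ell2_summable]) auto

lemma ell2_norm_apply_le: "norm (ell2_apply \<xi> g) \<le> norm \<xi>"
proof (rule power2_le_imp_le)
  show "(norm (ell2_apply \<xi> g))\<^sup>2 \<le> (norm \<xi>)\<^sup>2"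
    using ell2_sum_le_norm[of "{g}" \<xi>] by simp
qed simp

lemma ell2_apply_add: "ell2_apply (\<xi> + \<eta>) g = ell2_apply \<xi> g + ell2_apply \<eta> g"
  by (simp add: plus_ell2.rep_eq)

lemma ell2_apply_diff: "ell2_apply (\<xi> - \<eta>) g = ell2_apply \<xi> g - ell2_apply \<eta> g"
  unfolding minus_ell2_def plus_ell2.rep_eq uminus_ell2.rep_eq by simp

lemma ell2_bounded_partial_sums:
  assumes "\<And>F. finite F \<Longrightarrow> (\<Sum>g\<in>F. (norm (f g))\<^sup>2) \<le> C\<^sup>2"
  shows "(\<lambda>g. (norm (f g))\<^sup>2) summable_on UNIV" "(\<Sum>\<^sub>\<infinity>g. (norm (f g))\<^sup>2) \<le> C\<^sup>2"
proof -
  show *: "(\<lambda>g. (norm (f g))\<^sup>2) summable_on UNIV"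
    by (rule nonneg_bounded_partial_sums_imp_summable_on[where C = "C\<^sup>2"])
      (simp, rule eventually_finite_subsets_at_top_weakI, rule assms)
  show "(\<Sum>\<^sub>\<infinity>g. (norm (f g))\<^sup>2) \<le> C\<^sup>2"
    by (rule infsum_le_finite_sums[OF *]) (use assms in auto)
qed

instance ell2 :: (type, chilbert_space) chilbert_space
proof
  fix X :: "nat \<Rightarrow> ('a, 'b) ell2"
  assume C: "Cauchy X"
  have "Cauchy (\<lambda>n. ell2_apply (X n) g)" for g
  proof (rule metric_CauchyI)
    fix e :: real assume "e > 0"
    then obtain N where "\<And>m n. m \<ge> N \<Longrightarrow> n \<ge> N \<Longrightarrow> dist (X m) (X n) < e"
      using metric_CauchyD[OF C, of e] by auto
    moreover have "dist (ell2_apply (X m) g) (ell2_apply (X n) g) \<le> dist (X m) (X n)" for m n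
      using ell2_norm_apply_le[of "X m - X n" g] by (simp add: dist_norm ell2_apply_diff)
    ultimately show "\<exists>N. \<forall>m\<ge>N. \<forall>n\<ge>N. dist (ell2_apply (X m) g) (ell2_apply (X n) g) < e"
      using order_le_less_trans by blast
  qed
  then have "\<forall>g. \<exists>l. (\<lambda>n. ell2_apply (X n) g) \<longlonglongrightarrow> l"
    by (simp add: Cauchy_convergent_iff convergent_def)
  then obtain L where L: "\<And>g. (\<lambda>n. ell2_apply (X n) g) \<longlonglongrightarrow> L g"
    by metis
  have tail: "(\<Sum>g\<in>F. (norm (ell2_apply (X m) g - L g))\<^sup>2) \<le> e\<^sup>2"
    if N: "\<And>m n. m \<ge> N \<Longrightarrow> n \<ge> N \<Longrightarrow> dist (X m) (X n) < e" and "m \<ge> N" and F: "finite F"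
    for e N m and F :: "'a set"
  proof (rule tendsto_upperbound)
    show "(\<lambda>n. \<Sum>g\<in>F. (norm (ell2_apply (X m) g - ell2_apply (X n) g))\<^sup>2)
        \<longlonglongrightarrow> (\<Sum>g\<in>F. (norm (ell2_apply (X m) g - L g))\<^sup>2)"
      by (intro tendsto_intros L)
    have "(\<Sum>g\<in>F. (norm (ell2_apply (X m) g - ell2_apply (X n) g))\<^sup>2) \<le> e\<^sup>2" if "n \<ge> N" for n
    proof -
      have "(\<Sum>g\<in>F. (norm (ell2_apply (X m) g - ell2_apply (X n) g))\<^sup>2) \<le> (norm (X m - X n))\<^sup>2"
        using ell2_sum_le_norm[OF F, of "X m - X n"] by (simp add: ell2_apply_diff)
      also have "\<dots> \<le> e\<^sup>2"
        using N[OF \<open>m \<ge> N\<close> \<open>n \<ge> N\<close>] by (intro power_mono) (auto simp: dist_norm)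
      finally show ?thesis .
    qed
    then show "\<forall>\<^sub>F n in sequentially.
        (\<Sum>g\<in>F. (norm (ell2_apply (X m) g - ell2_apply (X n) g))\<^sup>2) \<le> e\<^sup>2"
      by (auto simp: eventually_sequentially)
  qed simp
  obtain N1 where N1: "\<And>m n. m \<ge> N1 \<Longrightarrow> n \<ge> N1 \<Longrightarrow> dist (X m) (X n) < 1"
    using metric_CauchyD[OF C, of 1] by auto
  define D where "D = Abs_ell2 (\<lambda>g. ell2_apply (X N1) g - L g)"
  have D: "ell2_apply D g = ell2_apply (X N1) g - L g" for g
    unfolding D_def using ell2_bounded_partial_sums(1)[OF tail[OF N1 order_refl]]
    by (subst Abs_ell2_inverse) auto
  define \<xi> where "\<xi> = X N1 - D"
  have \<xi>: "ell2_apply \<xi> g = L g" for g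
    by (simp add: \<xi>_def ell2_apply_diff D)
  have "X \<longlonglongrightarrow> \<xi>"
  proof (rule metric_LIMSEQ_I)
    fix e :: real assume "e > 0"
    then obtain N where N: "\<And>m n. m \<ge> N \<Longrightarrow> n \<ge> N \<Longrightarrow> dist (X m) (X n) < e / 2"
      using metric_CauchyD[OF C, of "e / 2"] by auto
    have "dist (X m) \<xi> < e" if "m \<ge> N" for m
    proof -
      have "(norm (X m - \<xi>))\<^sup>2 \<le> (e / 2)\<^sup>2"
        unfolding ell2_norm_square ell2_apply_diff \<xi>
        by (rule ell2_bounded_partial_sums(2)[OF tail[OF N that]])
      then show ?thesis
        using \<open>e > 0\<close> by (simp add: dist_norm power2_le_iff_abs_le)
    qed
    then show "\<exists>N. \<forall>m\<ge>N. dist (X m) \<xi> < e" by blast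
  qed
  then show "convergent X" by (auto simp: convergent_def)
qed


section \<open>Adjoints\<close>

lemma riesz_representation_real:
  fixes f :: "'a::{real_inner, complete_space} \<Rightarrow> real"
  assumes f: "bounded_linear f"
  shows "\<exists>z. \<forall>x. f x = inner x z"
proof -
  interpret f: bounded_linear f by fact
  define \<Phi> where "\<Phi> x = (norm x)\<^sup>2 - 2 * f x" for x
  obtain K where K: "\<And>x. norm (f x) \<le> norm x * K"
    using f.bounded by blast
  have lower: "- K\<^sup>2 \<le> \<Phi> x" for x
  proof -
    have "f x \<le> norm x * K" using K[of x] by simp
    moreover have "0 \<le> (norm x - K)\<^sup>2" by simp
    ultimately show ?thesis by (simp add: \<Phi>_def power2_eq_square algebra_simps)
  qed
  define m where "m = Inf (range \<Phi>)"
  have bdd: "bdd_below (range \<Phi>)" by (auto intro!: bdd_belowI lower)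
  have m: "m \<le> \<Phi> x" for x unfolding m_def by (rule cInf_lower[OF _ bdd]) simp
  have "\<exists>x. \<Phi> x < m + 1 / real (Suc n)" for n
    using cInf_lessD[of "range \<Phi>" "m + 1 / real (Suc n)"] by (auto simp: m_def)
  then obtain X where X: "\<And>n. \<Phi> (X n) < m + 1 / real (Suc n)" by metis
  have par: "(norm (x - y))\<^sup>2 \<le> 2 * \<Phi> x + 2 * \<Phi> y - 4 * m" for x y
  proof -
    have "(norm (x - y))\<^sup>2 = 2 * \<Phi> x + 2 * \<Phi> y - 4 * \<Phi> ((1 / 2) *\<^sub>R (x + y))"
      by (simp add: \<Phi>_def power2_norm_eq_inner f.add f.scaleR inner_add_left inner_add_right
          inner_diff_left inner_diff_right inner_commute algebra_simps)
    with m[of "(1 / 2) *\<^sub>R (x + y)"] show ?thesis by simp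
  qed
  have "Cauchy X"
  proof (rule metric_CauchyI)
    fix e :: real assume "e > 0"
    then obtain N where N: "inverse (real (Suc N)) < e\<^sup>2 / 4"
      using reals_Archimedean[of "e\<^sup>2 / 4"] by auto
    have "dist (X p) (X q) < e" if "p \<ge> N" "q \<ge> N" for p q
    proof -
      have "1 / real (Suc p) \<le> inverse (real (Suc N))" "1 / real (Suc q) \<le> inverse (real (Suc N))"
        using that by (auto simp: field_simps)
      then have "(norm (X p - X q))\<^sup>2 < e\<^sup>2"
        using par[of "X p" "X q"] X[of p] X[of q] N by linarith
      then show ?thesis
        using \<open>e > 0\<close> by (simp add: dist_norm power2_less_imp_less)
    qed
    then show "\<exists>N. \<forall>p\<ge>N. \<forall>q\<ge>N. dist (X p) (X q) < e" by blast
  qed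
  then obtain z where z: "X \<longlonglongrightarrow> z"
    by (auto simp: Cauchy_convergent_iff convergent_def)
  have "(\<lambda>n. \<Phi> (X n)) \<longlonglongrightarrow> \<Phi> z"
    unfolding \<Phi>_def by (intro tendsto_intros f.tendsto z)
  moreover have "(\<lambda>n. m + 1 / real (Suc n)) \<longlonglongrightarrow> m + 0"
    by (intro tendsto_intros LIMSEQ_inverse_real_of_nat[unfolded inverse_eq_divide])
  ultimately have "\<Phi> z \<le> m"
    using X by (intro LIMSEQ_le[of _ _ "\<lambda>n. m + 1 / real (Suc n)"]) (auto intro: less_imp_le)
  then have min: "\<Phi> z \<le> \<Phi> x" for x using m[of x] by linarith
  have "f v = inner v z" for v
  proof (rule ccontr)
    define d where "d = inner v z - f v"
    assume "f v \<noteq> inner v z"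
    then have d: "d \<noteq> 0" and "v \<noteq> 0" by (auto simp: d_def f.zero)
    define t where "t = - d / (norm v)\<^sup>2"
    have "\<Phi> (z + t *\<^sub>R v) = \<Phi> z + 2 * t * d + t\<^sup>2 * (norm v)\<^sup>2"
      unfolding \<Phi>_def d_def power2_norm_eq_inner
      by (simp add: f.add f.scaleR inner_add_left inner_add_right inner_commute[of z v]
          algebra_simps power2_eq_square)
    also have "\<dots> = \<Phi> z - d\<^sup>2 / (norm v)\<^sup>2"
      using \<open>v \<noteq> 0\<close> by (simp add: t_def field_simps power2_eq_square)
    also have "\<dots> < \<Phi> z" using d \<open>v \<noteq> 0\<close> by simp
    finally show False using min[of "z + t *\<^sub>R v"] by simp
  qed
  then show ?thesis by blast
qed

text \<open>
  The type \<^typ>\<open>'a \<Rightarrow>\<^sub>L 'b\<close> consists of the bounded real-linear maps; \<open>B(H)\<close> is the set of those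
  that satisfy the following predicate.
\<close>

definition clinear_op :: "('a::complex_inner \<Rightarrow>\<^sub>L 'b::complex_inner) \<Rightarrow> bool" where
  "clinear_op T \<longleftrightarrow> (\<forall>c x. blinfun_apply T (c *\<^sub>C x) = c *\<^sub>C blinfun_apply T x)"

text \<open>Characterised by \<open>adj_cinner\<close> below for complex-linear \<open>T\<close>; unspecified otherwise.\<close>

definition adj :: "('a::chilbert_space \<Rightarrow>\<^sub>L 'b::chilbert_space) \<Rightarrow> ('b \<Rightarrow>\<^sub>L 'a)" where
  "adj T = (THE S. \<forall>x y. cinner (blinfun_apply T x) y = cinner x (blinfun_apply S y))"

lemma adj_ex1:
  fixes T :: "'a::chilbert_space \<Rightarrow>\<^sub>L 'b::chilbert_space"
  assumes T: "clinear_op T"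
  shows "\<exists>!S. \<forall>x y. cinner (blinfun_apply T x) y = cinner x (blinfun_apply S y)"
proof (rule ex_ex1I)
  have "\<exists>z. \<forall>x. inner (blinfun_apply T x) y = inner x z" for y
    by (rule riesz_representation_real)
      (intro bounded_linear_compose[OF bounded_linear_inner_left] blinfun.bounded_linear_right)
  then obtain S where S: "\<And>x y. inner (blinfun_apply T x) y = inner x (S y)" by metis
  have eqI: "u = v" if "\<And>x. inner x u = inner x v" for u v :: 'a
    using that[of "u - v"] inner_eq_zero_iff[of "u - v"] by (simp add: inner_diff_right)
  have "bounded_linear S"
  proof (rule bounded_linear_intro[where K = "norm T"])
    fix y y' :: 'b and r :: real
    show "S (y + y') = S y + S y'" by (rule eqI) (simp add: inner_add_right flip: S)
    show "S (r *\<^sub>R y) = r *\<^sub>R S y" by (rule eqI) (simp flip: S)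
    have "(norm (S y))\<^sup>2 \<le> norm (blinfun_apply T (S y)) * norm y"
      unfolding power2_norm_eq_inner S[symmetric] by (rule norm_cauchy_schwarz)
    also have "\<dots> \<le> (norm T * norm (S y)) * norm y"
      by (intro mult_right_mono norm_blinfun) simp
    finally have "norm (S y) * norm (S y) \<le> (norm y * norm T) * norm (S y)"
      by (simp add: power2_eq_square algebra_simps)
    then show "norm (S y) \<le> norm y * norm T"
      by (cases "norm (S y) = 0") (auto simp: mult_le_cancel_right)
  qed
  then have "cinner (blinfun_apply T x) y = cinner x (blinfun_apply (Blinfun S) y)" for x y
  proof -
    have Im: "Im (cinner u w) = - inner (\<i> *\<^sub>C u) w" for u w :: "'c::complex_inner"
      by (simp add: inner_eq_Re_cinner cinner_scaleC_left)
    have "inner (\<i> *\<^sub>C blinfun_apply T x) y = inner (\<i> *\<^sub>C x) (S y)"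
      using T by (simp add: clinear_op_def flip: S)
    then show ?thesis
      using \<open>bounded_linear S\<close> S[of x y]
      by (simp add: complex_eq_iff Im bounded_linear_Blinfun_apply flip: inner_eq_Re_cinner)
  qed
  then show "\<exists>S. \<forall>x y. cinner (blinfun_apply T x) y = cinner x (blinfun_apply S y)" by blast
next
  fix S S' :: "'b \<Rightarrow>\<^sub>L 'a"
  assume "\<forall>x y. cinner (blinfun_apply T x) y = cinner x (blinfun_apply S y)"
    and "\<forall>x y. cinner (blinfun_apply T x) y = cinner x (blinfun_apply S' y)"
  then have "inner x (blinfun_apply S y) = inner x (blinfun_apply S' y)" for x y
    by (simp add: inner_eq_Re_cinner)
  then have "inner (blinfun_apply S y - blinfun_apply S' y) (blinfun_apply S y - blinfun_apply S' y) = 0"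
    for y
    by (simp add: inner_diff_right)
  then show "S = S'" by (intro blinfun_eqI) simp
qed

lemma adj_cinner:
  "clinear_op T \<Longrightarrow> cinner (blinfun_apply T x) y = cinner x (blinfun_apply (adj T) y)"
  unfolding adj_def by (rule theI'[OF adj_ex1, rule_format])


section \<open>Von Neumann algebras and traces\<close>

definition scaleC_op :: "complex \<Rightarrow> 'a::complex_inner \<Rightarrow>\<^sub>L 'a" where
  "scaleC_op c = Blinfun (\<lambda>x. c *\<^sub>C x)"

lemma scaleC_op_apply [simp]: "blinfun_apply (scaleC_op c) x = c *\<^sub>C x"
  by (simp add: scaleC_op_def bounded_linear_Blinfun_apply bounded_linear_scaleC)

definition von_neumann_algebra :: "('h::chilbert_space \<Rightarrow>\<^sub>L 'h) set \<Rightarrow> bool" where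
  "von_neumann_algebra M \<longleftrightarrow>
     (\<forall>x\<in>M. clinear_op x) \<and> id_blinfun \<in> M \<and>
     (\<forall>x\<in>M. \<forall>y\<in>M. x + y \<in> M) \<and> (\<forall>c. \<forall>x\<in>M. scaleC_op c o\<^sub>L x \<in> M) \<and>
     (\<forall>x\<in>M. \<forall>y\<in>M. x o\<^sub>L y \<in> M) \<and> (\<forall>x\<in>M. adj x \<in> M) \<and>
     closedin strong_operator_topology M"

definition finite_von_neumann_algebra :: "('h::chilbert_space \<Rightarrow>\<^sub>L 'h) set \<Rightarrow> bool" where
  "finite_von_neumann_algebra M \<longleftrightarrow>
     von_neumann_algebra M \<and>
     (\<forall>v\<in>M. adj v o\<^sub>L v = id_blinfun \<longrightarrow> v o\<^sub>L adj v = id_blinfun)"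

definition vna_generated :: "('h::chilbert_space \<Rightarrow>\<^sub>L 'h) set \<Rightarrow> ('h \<Rightarrow>\<^sub>L 'h) set" where
  "vna_generated S = \<Inter> {N. von_neumann_algebra N \<and> S \<subseteq> N}"

definition positive_op :: "('h::chilbert_space \<Rightarrow>\<^sub>L 'h) \<Rightarrow> bool" where
  "positive_op x \<longleftrightarrow> clinear_op x \<and> (\<forall>\<xi>. cinner (blinfun_apply x \<xi>) \<xi> \<in> \<real>\<^sub>\<ge>\<^sub>0)"

definition op_le :: "('h::chilbert_space \<Rightarrow>\<^sub>L 'h) \<Rightarrow> ('h \<Rightarrow>\<^sub>L 'h) \<Rightarrow> bool" where
  "op_le x y \<longleftrightarrow> positive_op (y - x)"

text \<open>Only the values of \<open>\<tau>\<close> on \<open>M\<close> matter.\<close>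

definition state_on :: "('h::chilbert_space \<Rightarrow>\<^sub>L 'h) set \<Rightarrow> (('h \<Rightarrow>\<^sub>L 'h) \<Rightarrow> complex) \<Rightarrow> bool" where
  "state_on M \<tau> \<longleftrightarrow>
     (\<forall>x\<in>M. \<forall>y\<in>M. \<tau> (x + y) = \<tau> x + \<tau> y) \<and> (\<forall>c. \<forall>x\<in>M. \<tau> (scaleC_op c o\<^sub>L x) = c * \<tau> x) \<and>
     (\<forall>x\<in>M. positive_op x \<longrightarrow> \<tau> x \<in> \<real>\<^sub>\<ge>\<^sub>0) \<and> \<tau> id_blinfun = 1"

definition tracial_on :: "('h::chilbert_space \<Rightarrow>\<^sub>L 'h) set \<Rightarrow> (('h \<Rightarrow>\<^sub>L 'h) \<Rightarrow> complex) \<Rightarrow> bool" where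
  "tracial_on M \<tau> \<longleftrightarrow> (\<forall>x\<in>M. \<forall>y\<in>M. \<tau> (x o\<^sub>L y) = \<tau> (y o\<^sub>L x))"

definition faithful_on :: "('h::chilbert_space \<Rightarrow>\<^sub>L 'h) set \<Rightarrow> (('h \<Rightarrow>\<^sub>L 'h) \<Rightarrow> complex) \<Rightarrow> bool" where
  "faithful_on M \<tau> \<longleftrightarrow> (\<forall>x\<in>M. \<tau> (adj x o\<^sub>L x) = 0 \<longrightarrow> x = 0)"

definition op_lub_in ::
  "('h::chilbert_space \<Rightarrow>\<^sub>L 'h) set \<Rightarrow> ('h \<Rightarrow>\<^sub>L 'h) set \<Rightarrow> ('h \<Rightarrow>\<^sub>L 'h) \<Rightarrow> bool" where
  "op_lub_in M D x \<longleftrightarrow>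
     x \<in> M \<and> (\<forall>d\<in>D. op_le d x) \<and> (\<forall>y\<in>M. (\<forall>d\<in>D. op_le d y) \<longrightarrow> op_le x y)"

text \<open>
  Normality of a positive functional: it preserves suprema of bounded increasing nets of positive
  elements, here written as upward directed sets.
\<close>

definition normal_on :: "('h::chilbert_space \<Rightarrow>\<^sub>L 'h) set \<Rightarrow> (('h \<Rightarrow>\<^sub>L 'h) \<Rightarrow> complex) \<Rightarrow> bool" where
  "normal_on M \<tau> \<longleftrightarrow>
     (\<forall>D x. D \<noteq> {} \<and> D \<subseteq> {d \<in> M. positive_op d} \<and>
        (\<forall>a\<in>D. \<forall>b\<in>D. \<exists>c\<in>D. op_le a c \<and> op_le b c) \<and> op_lub_in M D x \<longrightarrow>
        Re (\<tau> x) = (SUP d\<in>D. Re (\<tau> d)))"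

definition faithful_normal_tracial_state ::
  "('h::chilbert_space \<Rightarrow>\<^sub>L 'h) set \<Rightarrow> (('h \<Rightarrow>\<^sub>L 'h) \<Rightarrow> complex) \<Rightarrow> bool" where
  "faithful_normal_tracial_state M \<tau> \<longleftrightarrow>
     state_on M \<tau> \<and> tracial_on M \<tau> \<and> faithful_on M \<tau> \<and> normal_on M \<tau>"


section \<open>Group actions and crossed products\<close>

text \<open>
  A discrete group is a type of class \<^class>\<open>group_add\<close>. This class does not assume commutativity;
  \<open>g + h\<close>, \<open>- g\<close> and \<open>0\<close> stand for \<open>gh\<close>, the inverse of \<open>g\<close>, and the unit \<open>e\<close>.
\<close>

definition subgroup_add :: "'g::group_add set \<Rightarrow> bool" where
  "subgroup_add H \<longleftrightarrow> 0 \<in> H \<and> (\<forall>g\<in>H. \<forall>h\<in>H. g + h \<in> H) \<and> (\<forall>g\<in>H. - g \<in> H)"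

definition star_automorphism ::
  "('h::chilbert_space \<Rightarrow>\<^sub>L 'h) set \<Rightarrow> (('h \<Rightarrow>\<^sub>L 'h) \<Rightarrow> ('h \<Rightarrow>\<^sub>L 'h)) \<Rightarrow> bool" where
  "star_automorphism M \<phi> \<longleftrightarrow>
     bij_betw \<phi> M M \<and>
     (\<forall>x\<in>M. \<forall>y\<in>M. \<phi> (x + y) = \<phi> x + \<phi> y) \<and>
     (\<forall>c. \<forall>x\<in>M. \<phi> (scaleC_op c o\<^sub>L x) = scaleC_op c o\<^sub>L \<phi> x) \<and>
     (\<forall>x\<in>M. \<forall>y\<in>M. \<phi> (x o\<^sub>L y) = \<phi> x o\<^sub>L \<phi> y) \<and>
     (\<forall>x\<in>M. \<phi> (adj x) = adj (\<phi> x))"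

definition acts_by_star_automorphisms ::
  "('h::chilbert_space \<Rightarrow>\<^sub>L 'h) set \<Rightarrow> ('g::group_add \<Rightarrow> ('h \<Rightarrow>\<^sub>L 'h) \<Rightarrow> ('h \<Rightarrow>\<^sub>L 'h)) \<Rightarrow> bool" where
  "acts_by_star_automorphisms M \<alpha> \<longleftrightarrow>
     (\<forall>g. star_automorphism M (\<alpha> g)) \<and>
     (\<forall>x\<in>M. \<alpha> 0 x = x) \<and> (\<forall>g h. \<forall>x\<in>M. \<alpha> (g + h) x = \<alpha> g (\<alpha> h x))"

text \<open>
  For \<open>a \<in> M\<close> the formula defines a bounded operator because *-automorphisms are isometric.
\<close>

definition pi_rep ::
  "('g::group_add \<Rightarrow> ('h::chilbert_space \<Rightarrow>\<^sub>L 'h) \<Rightarrow> ('h \<Rightarrow>\<^sub>L 'h)) \<Rightarrow> ('h \<Rightarrow>\<^sub>L 'h) \<Rightarrow>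
     ('g, 'h) ell2 \<Rightarrow>\<^sub>L ('g, 'h) ell2" where
  "pi_rep \<alpha> a = Blinfun (\<lambda>\<xi>. Abs_ell2 (\<lambda>g. blinfun_apply (\<alpha> (- g) a) (ell2_apply \<xi> g)))"

definition lambda_rep :: "'g::group_add \<Rightarrow> ('g, 'h::chilbert_space) ell2 \<Rightarrow>\<^sub>L ('g, 'h) ell2" where
  "lambda_rep g = Blinfun (\<lambda>\<xi>. Abs_ell2 (\<lambda>h. ell2_apply \<xi> (- g + h)))"

definition crossed_product ::
  "('h::chilbert_space \<Rightarrow>\<^sub>L 'h) set \<Rightarrow> ('g::group_add \<Rightarrow> ('h \<Rightarrow>\<^sub>L 'h) \<Rightarrow> ('h \<Rightarrow>\<^sub>L 'h)) \<Rightarrow> 'g set \<Rightarrow>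
     (('g, 'h) ell2 \<Rightarrow>\<^sub>L ('g, 'h) ell2) set" where
  "crossed_product M \<alpha> H = vna_generated (pi_rep \<alpha> ` M \<union> lambda_rep ` H)"

definition P_e :: "('g::group_add, 'h::chilbert_space) ell2 \<Rightarrow>\<^sub>L 'h" where
  "P_e = Blinfun (\<lambda>\<xi>. ell2_apply \<xi> 0)"

definition cond_exp ::
  "(('g::group_add, 'h::chilbert_space) ell2 \<Rightarrow>\<^sub>L ('g, 'h) ell2) \<Rightarrow> ('h \<Rightarrow>\<^sub>L 'h)" where
  "cond_exp z = P_e o\<^sub>L z o\<^sub>L adj P_e"

definition canonical_trace ::
  "(('h::chilbert_space \<Rightarrow>\<^sub>L 'h) \<Rightarrow> complex) \<Rightarrow>
     (('g::group_add, 'h) ell2 \<Rightarrow>\<^sub>L ('g, 'h) ell2) \<Rightarrow> complex" where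
  "canonical_trace \<tau> z = \<tau> (cond_exp z)"


section \<open>The Mashood--Taylor distance\<close>

definition trace_norm ::
  "(('h::chilbert_space \<Rightarrow>\<^sub>L 'h) \<Rightarrow> complex) \<Rightarrow> ('h \<Rightarrow>\<^sub>L 'h) \<Rightarrow> real" where
  "trace_norm \<tau> x = sqrt (Re (\<tau> (adj x o\<^sub>L x)))"

text \<open>The suprema are meaningful for nonempty sets that are bounded with respect to \<open>d\<close>.\<close>

definition hausdorff_distance :: "('a \<Rightarrow> 'a \<Rightarrow> real) \<Rightarrow> 'a set \<Rightarrow> 'a set \<Rightarrow> real" where
  "hausdorff_distance d A B =
     max (SUP a\<in>A. INF b\<in>B. d a b) (SUP b\<in>B. INF a\<in>A. d a b)"

definition op_unit_ball :: "('h::chilbert_space \<Rightarrow>\<^sub>L 'h) set \<Rightarrow> ('h \<Rightarrow>\<^sub>L 'h) set" where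
  "op_unit_ball P = {x \<in> P. norm x \<le> 1}"

text \<open>
  The distance of \<open>x\<close> and \<open>y\<close> as elements of \<open>L\<^sup>2(N, \<tau>)\<close> is \<^term>\<open>trace_norm \<tau> (x - y)\<close>, so the
  Hausdorff distance is taken on the operators themselves.
\<close>

definition mashood_taylor_distance ::
  "(('h::chilbert_space \<Rightarrow>\<^sub>L 'h) \<Rightarrow> complex) \<Rightarrow> ('h \<Rightarrow>\<^sub>L 'h) set \<Rightarrow> ('h \<Rightarrow>\<^sub>L 'h) set \<Rightarrow> real" where
  "mashood_taylor_distance \<tau> P Q =
     hausdorff_distance (\<lambda>x y. trace_norm \<tau> (x - y)) (op_unit_ball P) (op_unit_ball Q)"

end

theory Submission
  imports Defs
begin

text \<open>
  Write \<open>z\<^sub>g\<^sub>h\<close> for the matrix entries in \<open>B(\<H>)\<close> of an operator \<open>z\<close> on \<open>\<ell>\<^sup>2(G, \<H>)\<close>. The generator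
  \<open>\<pi>(a)\<close> is diagonal with entries \<open>\<alpha>\<close>-translates of \<open>a\<close>, and the entries of \<open>\<lambda>(s)\<close> are \<open>1\<close> where
  \<open>gh\<inverse> = s\<close> and \<open>0\<close> elsewhere. So all generators of \<open>M \<rtimes> H\<close> lie in the set \<open>matrices_over M H\<close> of
  operators with all entries in \<open>M\<close> and with \<open>z\<^sub>g\<^sub>h = 0\<close> unless \<open>gh\<inverse> \<in> H\<close>. This set is itself a von
  Neumann algebra (\<open>von_neumann_algebra_matrices_over\<close>): an entry of a product is the strong limit
  of the finite sums \<open>\<Sum>\<^sub>k z\<^sub>g\<^sub>k w\<^sub>k\<^sub>h\<close>, \<open>M\<close> is strongly closed, and \<open>gk\<inverse>, kh\<inverse> \<in> H\<close> imply \<open>gh\<inverse> \<in> H\<close>. Hence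
  it contains \<open>M \<rtimes> H\<close>.

  The trace norm depends only on the vectors \<open>z(\<delta>\<^sub>e \<otimes> v)\<close>, because
  \<open>\<langle>E(z\<^sup>*z)v, v\<rangle> = \<parallel>z(\<delta>\<^sub>e \<otimes> v)\<parallel>\<^sup>2\<close>. If these norms are all at most \<open>\<parallel>v\<parallel>\<close>, then \<open>E(z\<^sup>*z) \<le> 1\<close> and the
  trace norm of \<open>z\<close> is at most \<open>1\<close>; if they are all at least \<open>\<parallel>v\<parallel>\<close>, it is at least \<open>1\<close>. The first
  case covers the operator unit ball, so every point of either ball is within \<open>1\<close> of the common
  point \<open>0\<close>, and the Hausdorff distance is at most \<open>1\<close>. For the lower bound take \<open>g\<close> in one of the
  subgroups and not in the other, say \<open>g \<in> H - K\<close>, and \<open>y\<close> in the ball of \<open>M \<rtimes> K\<close>. Then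
  \<open>\<lambda>(g)(\<delta>\<^sub>e \<otimes> v) = \<delta>\<^sub>g \<otimes> v\<close> is orthogonal to \<open>y(\<delta>\<^sub>e \<otimes> v)\<close>, whose value at \<open>g\<close> is \<open>y\<^sub>g\<^sub>e v = 0\<close>. So
  \<open>\<lambda>(g) - y\<close> is in the second case, and \<open>\<lambda>(g)\<close> has distance at least \<open>1\<close> from the whole ball of
  \<open>M \<rtimes> K\<close> (\<open>norm_le_lambda_rep_diff\<close>).

  One analytic point remains: \<open>\<pi>(a)\<close> is a bounded operator only if the norms of the \<open>\<alpha>\<^sub>g(a)\<close> are
  bounded in \<open>g\<close>. This is \<open>star_automorphism_norm_le\<close>. It rests on writing \<open>1 - a\<^sup>*a\<close> as the square
  of a selfadjoint element of \<open>M\<close>, which a *-automorphism must respect.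
\<close>

section \<open>Complex inner products and adjoints\<close>

text \<open>This makes the operators between Hilbert spaces complete in the operator norm.\<close>

instance chilbert_space \<subseteq> banach ..

lemma scaleC_zero_right [simp]: "c *\<^sub>C (0::'a::complex_inner) = 0"
  using norm_scaleC[of c "0::'a"] by simp

lemma scaleC_minus_one: "(- 1) *\<^sub>C (x::'a::complex_inner) = - x"
  using scaleR_scaleC[of "- 1" x] by simp

lemma cinner_zero_right [simp]: "cinner x (0::'a::complex_inner) = 0"
  using cinner_add_right[of x 0 "0::'a"] by simp

lemma cinner_zero_left [simp]: "cinner (0::'a::complex_inner) x = 0"
  using cinner_add_left[of "0::'a" 0 x] by simp

lemma cinner_diff_right: "cinner x (y - z) = cinner x y - cinner x (z::'a::complex_inner)"
  using cinner_add_right[of x "y - z" z] by simp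

lemma cinner_diff_left: "cinner (x - y) z = cinner x z - cinner y (z::'a::complex_inner)"
  using cinner_add_left[of "x - y" y z] by simp

lemma cinner_eqI: "(\<And>x. cinner x u = cinner x v) \<Longrightarrow> u = (v::'a::complex_inner)"
  using cinner_diff_right[of "u - v" u v] cinner_self[of "u - v"] by simp

lemma clinear_op_compose: "clinear_op S \<Longrightarrow> clinear_op T \<Longrightarrow> clinear_op (S o\<^sub>L T)"
  by (simp add: clinear_op_def)

lemma clinear_op_id: "clinear_op id_blinfun"
  by (simp add: clinear_op_def)

lemma clinear_op_scaleC_op: "clinear_op (scaleC_op c)"
  by (simp add: clinear_op_def scaleC_scaleC mult.commute)

lemma clinear_op_add: "clinear_op S \<Longrightarrow> clinear_op T \<Longrightarrow> clinear_op (S + T)"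
  by (simp add: clinear_op_def blinfun.add_left scaleC_add_right)

lemma clinear_op_diff: "clinear_op S \<Longrightarrow> clinear_op T \<Longrightarrow> clinear_op (S - T)"
  using clinear_op_add[of "S - T" T]
  by (simp add: clinear_op_def blinfun.diff_left blinfun.diff_right)
     (metis (no_types) add_diff_cancel diff_add_cancel scaleC_add_right)

lemma adj_eqI:
  fixes T :: "'a::chilbert_space \<Rightarrow>\<^sub>L 'b::chilbert_space" and S :: "'b \<Rightarrow>\<^sub>L 'a"
  assumes "clinear_op T" and "\<And>x y. cinner (T x) y = cinner x (S y)"
  shows "adj T = S"
  unfolding adj_def by (rule the1_equality[OF adj_ex1[OF assms(1)]]) (simp add: assms(2))

lemma cinner_adj:
  "clinear_op T \<Longrightarrow> cinner (adj T x) y = cinner x (T y)"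
  using adj_cinner[of T y x] cinner_commute[of "adj T x" y] cinner_commute[of x "T y"] by simp

lemma blinfun_compose_assoc: "(S o\<^sub>L T) o\<^sub>L U = S o\<^sub>L (T o\<^sub>L U)"
  by (rule blinfun_eqI) simp

lemma clinear_op_adj:
  assumes "clinear_op T" shows "clinear_op (adj T)"
  unfolding clinear_op_def
  by (intro allI cinner_eqI) (simp add: adj_cinner[OF assms, symmetric] cinner_scaleC_right)

lemma adj_adj: "clinear_op T \<Longrightarrow> adj (adj T) = T"
  by (intro adj_eqI clinear_op_adj cinner_adj)

lemma adj_compose:
  assumes "clinear_op S" "clinear_op T"
  shows "adj (S o\<^sub>L T) = adj T o\<^sub>L adj S"
  by (intro adj_eqI clinear_op_compose assms) (simp add: adj_cinner assms)

lemma cinner_adj_compose_self: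
  assumes "clinear_op T"
  shows "cinner ((adj T o\<^sub>L T) x) x = complex_of_real ((norm (T x))\<^sup>2)"
  by (simp add: cinner_adj assms cinner_self power2_norm_eq_inner)

lemma norm_adj_compose_self_le:
  assumes "clinear_op T"
  shows "norm (adj T o\<^sub>L T) \<le> (norm T)\<^sup>2"
proof (rule norm_blinfun_bound)
  fix x
  let ?y = "(adj T o\<^sub>L T) x"
  have "(norm ?y)\<^sup>2 = inner (T x) (T ?y)"
    using cinner_adj[OF assms, of "T x" ?y]
    by (simp add: power2_norm_eq_inner inner_eq_Re_cinner)
  also have "\<dots> \<le> norm (T x) * norm (T ?y)" by (rule norm_cauchy_schwarz)
  also have "\<dots> \<le> (norm T * norm x) * (norm T * norm ?y)"
    by (intro mult_mono norm_blinfun) simp_all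
  finally have "norm ?y * norm ?y \<le> ((norm T)\<^sup>2 * norm x) * norm ?y"
    by (simp add: power2_eq_square algebra_simps)
  then show "norm ?y \<le> (norm T)\<^sup>2 * norm x"
    by (cases "norm ?y = 0") (auto simp: mult_le_cancel_right)
qed simp


section \<open>Strongly closed sets of operators\<close>

lemma closedin_strong_imp_closed:
  assumes "closedin strong_operator_topology S"
  shows "closed S"
  using closedin_continuous_map_preimage[OF strong_operator_topology_weaker_than_euclidean assms]
  by simp

lemma closedin_strong_eq:
  fixes a b :: "('x::real_normed_vector \<Rightarrow>\<^sub>L 'y::real_normed_vector) \<Rightarrow> 'z::real_normed_vector"
  assumes "continuous_map strong_operator_topology euclidean a"
    and "continuous_map strong_operator_topology euclidean b"
  shows "closedin strong_operator_topology {T. a T = b T}"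
proof -
  have "continuous_map strong_operator_topology euclidean (\<lambda>T. a T - b T)"
    by (intro continuous_intros assms)
  from closedin_continuous_map_preimage[OF this, of "{0}"] show ?thesis
    by (simp add: strong_operator_topology_topspace)
qed

text \<open>
  Both factors are fixed here; joint continuity of composition fails for the strong topology.
\<close>

lemma continuous_map_strong_compose:
  fixes S :: "'y::real_normed_vector \<Rightarrow>\<^sub>L 'z::real_normed_vector"
    and T :: "'w::real_normed_vector \<Rightarrow>\<^sub>L 'x::real_normed_vector"
  shows "continuous_map strong_operator_topology strong_operator_topology
           (\<lambda>z. S o\<^sub>L z o\<^sub>L T)"
proof -
  have S: "continuous_map euclidean euclidean (blinfun_apply S)"
    by (simp add: linear_continuous_on blinfun.bounded_linear_right)
  have "continuous_map strong_operator_topology euclidean (\<lambda>z. (S o\<^sub>L z o\<^sub>L T) x)" for x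
    using continuous_map_compose[OF strong_operator_topology_continuous_evaluation[of "T x"] S]
    by (simp add: o_def)
  then show ?thesis
    unfolding continuous_on_strong_operator_topo_iff_coordinatewise by blast
qed

lemma closedin_strong_clinear_op:
  "closedin strong_operator_topology
     {T :: 'x::complex_inner \<Rightarrow>\<^sub>L 'y::complex_inner. clinear_op T}"
proof -
  have "closedin strong_operator_topology {T :: 'x \<Rightarrow>\<^sub>L 'y. T (c *\<^sub>C x) = c *\<^sub>C T x}" for c x
  proof (rule closedin_strong_eq[OF strong_operator_topology_continuous_evaluation])
    have "continuous_map strong_operator_topology euclidean
        ((\<lambda>v::'y. c *\<^sub>C v) \<circ> (\<lambda>T :: 'x \<Rightarrow>\<^sub>L 'y. T x))"
      by (rule continuous_map_compose[OF strong_operator_topology_continuous_evaluation])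
        (simp add: linear_continuous_on bounded_linear_scaleC)
    then show "continuous_map strong_operator_topology euclidean (\<lambda>T :: 'x \<Rightarrow>\<^sub>L 'y. c *\<^sub>C T x)"
      by (simp add: o_def)
  qed
  then have "closedin strong_operator_topology
      (\<Inter>c. \<Inter>x. {T :: 'x \<Rightarrow>\<^sub>L 'y. T (c *\<^sub>C x) = c *\<^sub>C T x})"
    by (intro closedin_Inter) auto
  moreover have "(\<Inter>c. \<Inter>x. {T :: 'x \<Rightarrow>\<^sub>L 'y. T (c *\<^sub>C x) = c *\<^sub>C T x}) = {T. clinear_op T}"
    by (auto simp: clinear_op_def)
  ultimately show ?thesis by simp
qed

lemma closedin_strong_zero:
  "closedin strong_operator_topology {0 :: 'x::real_normed_vector \<Rightarrow>\<^sub>L 'y::real_normed_vector}"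
proof -
  have "closedin strong_operator_topology (\<Inter>x. {T :: 'x \<Rightarrow>\<^sub>L 'y. T x = 0})"
    by (intro closedin_Inter)
      (auto intro: closedin_strong_eq strong_operator_topology_continuous_evaluation)
  moreover have "(\<Inter>x. {T :: 'x \<Rightarrow>\<^sub>L 'y. T x = 0}) = {0}"
    by (auto intro: blinfun_eqI)
  ultimately show ?thesis by simp
qed

text \<open>
  The strong topology is that of pointwise convergence, so limits along filters, not only along
  sequences, may be taken pointwise. Matrix products over a group, which may be uncountable, are
  limits along its finite subsets and need this generality.
\<close>

lemma closedin_strong_pointwise_limit:
  fixes f :: "'i \<Rightarrow> 'x::real_normed_vector \<Rightarrow>\<^sub>L 'y::real_normed_vector"
    and T :: "'x \<Rightarrow>\<^sub>L 'y"
  assumes S: "closedin strong_operator_topology S"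
    and f: "\<forall>\<^sub>F i in F. f i \<in> S" and F: "F \<noteq> bot"
    and lim: "\<And>x. ((\<lambda>i. f i x) \<longlongrightarrow> T x) F"
  shows "T \<in> S"
proof (rule limitin_closedin[OF _ S f])
  show "limitin strong_operator_topology f T F"
    unfolding limitin_def
  proof (intro conjI allI impI)
    fix U assume "openin strong_operator_topology U \<and> T \<in> U"
    then obtain V where V: "open V" "U = blinfun_apply -` V" "blinfun_apply T \<in> V"
      by (auto simp: strong_operator_topology_def openin_pullback_topology)
    have "((\<lambda>i. blinfun_apply (f i)) \<longlongrightarrow> blinfun_apply T) F"
      using lim limitin_componentwise[of "\<lambda>_. euclidean" UNIV "\<lambda>i. blinfun_apply (f i)" "blinfun_apply T" F]
      by (simp add: euclidean_product_topology)
    from topological_tendstoD[OF this V(1) V(3)] show "\<forall>\<^sub>F i in F. f i \<in> U"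
      by (simp add: V(2))
  qed (simp add: strong_operator_topology_topspace)
qed (use F in simp)


section \<open>Von Neumann algebras and their *-automorphisms\<close>

lemma scaleR_eq_scaleC_op: "r *\<^sub>R T = scaleC_op (complex_of_real r) o\<^sub>L T"
  by (rule blinfun_eqI) (simp add: blinfun.scaleR_left scaleR_scaleC)

lemma uminus_eq_scaleC_op: "- T = scaleC_op (- 1) o\<^sub>L T"
  by (rule blinfun_eqI) (simp add: blinfun.minus_left scaleC_minus_one)

context
  fixes M :: "('h::chilbert_space \<Rightarrow>\<^sub>L 'h) set"
  assumes M: "von_neumann_algebra M"
begin

lemma vna_clinear: "x \<in> M \<Longrightarrow> clinear_op x"
  and vna_id: "id_blinfun \<in> M"
  and vna_add: "x \<in> M \<Longrightarrow> y \<in> M \<Longrightarrow> x + y \<in> M"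
  and vna_scaleC: "x \<in> M \<Longrightarrow> scaleC_op c o\<^sub>L x \<in> M"
  and vna_compose: "x \<in> M \<Longrightarrow> y \<in> M \<Longrightarrow> x o\<^sub>L y \<in> M"
  and vna_adj: "x \<in> M \<Longrightarrow> adj x \<in> M"
  and vna_closedin: "closedin strong_operator_topology M"
  using M by (auto simp: von_neumann_algebra_def)

lemma vna_scaleR: "x \<in> M \<Longrightarrow> r *\<^sub>R x \<in> M"
  by (simp add: scaleR_eq_scaleC_op vna_scaleC)

lemma vna_diff: "x \<in> M \<Longrightarrow> y \<in> M \<Longrightarrow> x - y \<in> M"
  using vna_add[of x "- y"] vna_scaleC[of y "- 1"] by (simp flip: uminus_eq_scaleC_op)

lemma vna_zero: "0 \<in> M"
  using vna_diff[OF vna_id vna_id] by simp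

lemma vna_sum: "(\<And>i. i \<in> I \<Longrightarrow> f i \<in> M) \<Longrightarrow> (\<Sum>i\<in>I. f i) \<in> M"
  by (induction I rule: infinite_finite_induct) (auto intro: vna_zero vna_add)

text \<open>
  With \<open>t = a\<^sup>*a\<close> and \<open>b = 1 - c\<close>, the equation \<open>b\<^sup>2 = 1 - t\<close> reads \<open>c = (t + c\<^sup>2) / 2\<close>. If
  \<open>q = \<parallel>a\<parallel>\<^sup>2 < 1\<close>, the right-hand side maps the selfadjoint elements of \<open>M\<close> of norm at most \<open>q\<close> into
  themselves, since \<open>(q + q\<^sup>2) / 2 \<le> q\<close>, and contracts distances by the factor \<open>q\<close>. So
  Banach's fixed point theorem gives the square root, and gives it inside \<open>M\<close>.
\<close>

lemma vna_complement_is_square: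
  assumes a: "a \<in> M" and norm_a: "norm a < 1"
  obtains b where "b \<in> M" "adj b = b" "(adj a o\<^sub>L a) + (b o\<^sub>L b) = id_blinfun"
proof -
  define q where "q = (norm a)\<^sup>2"
  define t where "t = adj a o\<^sub>L a"
  define f where "f c = (1 / 2) *\<^sub>R (t + (c o\<^sub>L c))" for c
  define S where "S = M \<inter> cball 0 q \<inter> {c :: 'h \<Rightarrow>\<^sub>L 'h. \<forall>x y. cinner (c x) y = cinner x (c y)}"
  have q: "0 \<le> q" "q < 1"
    using norm_a by (auto simp: q_def abs_square_less_1)
  have t: "t \<in> M" "norm t \<le> q" "\<And>x y. cinner (t x) y = cinner x (t y)"
    using a norm_adj_compose_self_le[OF vna_clinear[OF a]]
    by (auto simp: t_def q_def vna_compose vna_adj cinner_adj vna_clinear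
        adj_cinner[symmetric] clinear_op_adj)
  have "closed S"
  proof -
    have "closed {c :: 'h \<Rightarrow>\<^sub>L 'h. cinner (c x) y = cinner x (c y)}" for x y
      unfolding cinner_eq_inner complex.inject Collect_conj_eq
      by (intro closed_Int closed_Collect_eq continuous_intros)
        (auto intro!: continuous_on_compose2[OF linear_continuous_on[OF bounded_linear_scaleC]] continuous_intros)
    then have "closed (\<Inter>x. \<Inter>y. {c :: 'h \<Rightarrow>\<^sub>L 'h. cinner (c x) y = cinner x (c y)})"
      by blast
    also have "(\<Inter>x. \<Inter>y. {c :: 'h \<Rightarrow>\<^sub>L 'h. cinner (c x) y = cinner x (c y)})
        = {c :: 'h \<Rightarrow>\<^sub>L 'h. \<forall>x y. cinner (c x) y = cinner x (c y)}"
      by auto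
    finally show ?thesis
      unfolding S_def
      by (intro closed_Int closedin_strong_imp_closed[OF vna_closedin] closed_cball)
  qed
  have "\<exists>!c\<in>S. f c = c"
  proof (rule Banach_fix)
    show "complete S" using \<open>closed S\<close> by (simp add: complete_eq_closed)
    show "S \<noteq> {}" using q vna_zero by (auto simp: S_def intro!: exI[of _ 0])
    show "0 \<le> q" "q < 1" by (fact q)+
    show "f ` S \<subseteq> S"
    proof (clarify)
      fix c assume c: "c \<in> S"
      have "norm (c o\<^sub>L c) \<le> q * q"
        using c by (intro order_trans[OF norm_blinfun_compose] mult_mono) (auto simp: S_def q)
      also have "\<dots> \<le> q * 1" using q by (intro mult_left_mono) auto
      finally have "norm (t + (c o\<^sub>L c)) \<le> q + q"
        using t(2) by (intro order_trans[OF norm_triangle_ineq]) simp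
      then have "norm (f c) \<le> q" by (simp add: f_def)
      moreover have "f c \<in> M"
        using c t by (auto simp: f_def S_def intro: vna_scaleR vna_add vna_compose)
      moreover have "cinner (f c x) y = cinner x (f c y)" for x y
        using c t(3) by (simp add: f_def S_def blinfun.add_left blinfun.scaleR_left scaleR_scaleC
            cinner_scaleC_left cinner_scaleC_right cinner_add_left cinner_add_right)
      ultimately show "f c \<in> S" by (simp add: S_def)
    qed
    show "dist (f c) (f d) \<le> q * dist c d" if "c \<in> S" "d \<in> S" for c d
    proof -
      \<comment> \<open>As \<open>c\<close> and \<open>d\<close> need not commute, \<open>c\<^sup>2 - d\<^sup>2\<close> is split as \<open>c(c - d) + (c - d)d\<close>.\<close>
      have "f c - f d = (1 / 2) *\<^sub>R ((c o\<^sub>L (c - d)) + ((c - d) o\<^sub>L d))"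
        by (rule blinfun_eqI)
          (simp add: f_def blinfun.add_left blinfun.diff_left blinfun.scaleR_left
            blinfun.diff_right algebra_simps)
      then have "2 * norm (f c - f d) \<le> norm (c o\<^sub>L (c - d)) + norm ((c - d) o\<^sub>L d)"
        using norm_triangle_ineq[of "c o\<^sub>L (c - d)" "(c - d) o\<^sub>L d"] by simp
      also have "\<dots> \<le> q * norm (c - d) + norm (c - d) * q"
        using that
        by (intro add_mono order_trans[OF norm_blinfun_compose] mult_mono) (auto simp: S_def q)
      finally show ?thesis by (simp add: dist_norm)
    qed
  qed
  then obtain c where c: "c \<in> S" "f c = c" by blast
  show ?thesis
  proof
    show "id_blinfun - c \<in> M" using c vna_id by (auto simp: S_def intro: vna_diff)
    show "adj (id_blinfun - c) = id_blinfun - c"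
      using c by (intro adj_eqI clinear_op_diff clinear_op_id)
        (auto simp: S_def vna_clinear blinfun.diff_left cinner_diff_left cinner_diff_right)
    have "2 *\<^sub>R c = t + (c o\<^sub>L c)" by (subst c(2)[symmetric]) (simp add: f_def)
    then have "t x + c (c x) = c x + c x" for x
      by (metis blinfun.add_left blinfun.scaleR_left blinfun_apply_blinfun_compose scaleR_2)
    then have "t x + (x - c x - c (x - c x)) = x" for x
      by (simp add: blinfun.diff_right algebra_simps)
    then have "(t + ((id_blinfun - c) o\<^sub>L (id_blinfun - c))) x = id_blinfun x" for x
      by (simp only: blinfun.add_left blinfun.diff_left blinfun_apply_blinfun_compose
          blinfun_apply_id_blinfun id_apply)
    then show "(adj a o\<^sub>L a) + ((id_blinfun - c) o\<^sub>L (id_blinfun - c)) = id_blinfun"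
      unfolding t_def by (rule blinfun_eqI)
  qed
qed

lemma star_automorphism_in: "star_automorphism M \<phi> \<Longrightarrow> x \<in> M \<Longrightarrow> \<phi> x \<in> M"
  by (auto simp: star_automorphism_def bij_betw_def)

lemma star_automorphism_id:
  assumes "star_automorphism M \<phi>"
  shows "\<phi> id_blinfun = id_blinfun"
proof -
  have "id_blinfun \<in> \<phi> ` M"
    using assms vna_id by (simp add: star_automorphism_def bij_betw_def)
  then obtain y where y: "y \<in> M" "\<phi> y = id_blinfun" by auto
  have "\<phi> (id_blinfun o\<^sub>L y) = \<phi> id_blinfun o\<^sub>L \<phi> y"
    using assms y(1) vna_id by (auto simp: star_automorphism_def)
  moreover have "id_blinfun o\<^sub>L y = y" "\<phi> id_blinfun o\<^sub>L id_blinfun = \<phi> id_blinfun"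
    by (auto intro: blinfun_eqI)
  ultimately show ?thesis by (simp add: y(2))
qed

text \<open>
  Apply \<open>\<phi>\<close> to \<open>1 = a\<^sup>*a + b\<^sup>*b\<close>: the resulting identity says
  \<open>\<parallel>x\<parallel>\<^sup>2 = \<parallel>\<phi>(a)x\<parallel>\<^sup>2 + \<parallel>\<phi>(b)x\<parallel>\<^sup>2\<close> for every vector \<open>x\<close>.
\<close>

lemma star_automorphism_norm_le_1:
  assumes \<phi>: "star_automorphism M \<phi>" and a: "a \<in> M" "norm a < 1"
  shows "norm (\<phi> a) \<le> 1"
proof -
  obtain b where b: "b \<in> M" "adj b = b" "(adj a o\<^sub>L a) + (b o\<^sub>L b) = id_blinfun"
    using vna_complement_is_square[OF a] .
  have hom: "\<phi> (x + y) = \<phi> x + \<phi> y" "\<phi> (x o\<^sub>L y) = \<phi> x o\<^sub>L \<phi> y" "\<phi> (adj x) = adj (\<phi> x)"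
    if "x \<in> M" "y \<in> M" for x y
    using \<phi> that by (auto simp: star_automorphism_def)
  have lin: "clinear_op (\<phi> x)" if "x \<in> M" for x
    using star_automorphism_in[OF \<phi> that] by (rule vna_clinear)
  have "\<phi> id_blinfun = (adj (\<phi> a) o\<^sub>L \<phi> a) + (adj (\<phi> b) o\<^sub>L \<phi> b)"
    using hom(1)[of "adj a o\<^sub>L a" "b o\<^sub>L b"] hom(2)[of "adj a" a] hom(2)[of b b]
      hom(3)[of a a] hom(3)[of b b] a(1) b
    by (simp add: vna_adj vna_compose)
  then have id: "id_blinfun = (adj (\<phi> a) o\<^sub>L \<phi> a) + (adj (\<phi> b) o\<^sub>L \<phi> b)"
    by (simp add: star_automorphism_id[OF \<phi>])
  have *: "x = (adj (\<phi> a) o\<^sub>L \<phi> a) x + (adj (\<phi> b) o\<^sub>L \<phi> b) x" for x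
    using arg_cong[OF id, of "\<lambda>T. blinfun_apply T x"] by (simp add: blinfun.add_left)
  have "complex_of_real ((norm x)\<^sup>2) = complex_of_real ((norm (\<phi> a x))\<^sup>2 + (norm (\<phi> b x))\<^sup>2)" for x
  proof -
    have "cinner x x = cinner ((adj (\<phi> a) o\<^sub>L \<phi> a) x) x + cinner ((adj (\<phi> b) o\<^sub>L \<phi> b) x) x"
      by (subst (1) *) (rule cinner_add_left)
    then show ?thesis
      unfolding cinner_adj_compose_self[OF lin[OF a(1)]] cinner_adj_compose_self[OF lin[OF b(1)]]
      by (simp add: cinner_self power2_norm_eq_inner)
  qed
  then have pythagoras: "(norm x)\<^sup>2 = (norm (\<phi> a x))\<^sup>2 + (norm (\<phi> b x))\<^sup>2" for x
    unfolding of_real_eq_iff .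
  have "(norm (\<phi> a x))\<^sup>2 \<le> (norm x)\<^sup>2" for x
    unfolding pythagoras[of x] by simp
  then show ?thesis
    by (intro norm_blinfun_bound) (auto intro: power2_le_imp_le)
qed

text \<open>
  Although *-automorphisms are isometric, any bound that depends on \<open>a\<close> alone serves to define
  \<open>\<pi>(a)\<close>; this one follows by scaling \<open>a\<close> into the open unit ball.
\<close>

lemma star_automorphism_norm_le:
  assumes \<phi>: "star_automorphism M \<phi>" and a: "a \<in> M"
  shows "norm (\<phi> a) \<le> norm a + 1"
proof -
  define s where "s = 1 / (norm a + 1)"
  have pos: "0 < norm a + 1" by (rule add_nonneg_pos) simp_all
  then have s: "0 < s" "norm (s *\<^sub>R a) < 1"
    by (simp_all add: s_def)
  have "\<phi> (s *\<^sub>R a) = s *\<^sub>R \<phi> a"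
    using \<phi> a by (simp add: scaleR_eq_scaleC_op star_automorphism_def)
  then have "s * norm (\<phi> a) \<le> 1"
    using star_automorphism_norm_le_1[OF \<phi> vna_scaleR[OF a] s(2)] s(1) by simp
  then have "norm (\<phi> a) / (norm a + 1) \<le> 1" by (simp add: s_def)
  with pos show ?thesis by (simp only: pos_divide_le_eq mult_1)
qed

end


section \<open>Matrix entries of operators on square-summable families\<close>

lift_definition ell2_single :: "'g \<Rightarrow> 'h::chilbert_space \<Rightarrow> ('g, 'h) ell2"
  is "\<lambda>g x h. if h = g then x else 0"
proof -
  fix g :: 'g and x :: 'h
  have "(\<lambda>h. (norm (if h = g then x else 0))\<^sup>2) summable_on UNIV
      \<longleftrightarrow> (\<lambda>h. (norm (if h = g then x else 0))\<^sup>2) summable_on {g}"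
    by (rule summable_on_cong_neutral) auto
  then show "(\<lambda>h. (norm (if h = g then x else 0))\<^sup>2) summable_on UNIV" by simp
qed

lemma cinner_ell2_single:
  "cinner \<xi> (ell2_single g y) = cinner (ell2_apply \<xi> g) (y::'h::chilbert_space)"
proof -
  have "cinner \<xi> (ell2_single g y)
      = (\<Sum>\<^sub>\<infinity>h\<in>{g}. cinner (ell2_apply \<xi> h) (ell2_apply (ell2_single g y) h))"
    unfolding cinner_ell2_def
    by (rule infsum_cong_neutral) (auto simp: ell2_single.rep_eq)
  then show ?thesis by (simp add: ell2_single.rep_eq)
qed

lemma norm_ell2_single: "norm (ell2_single g x) = norm x"
proof -
  have "(norm (ell2_single g x))\<^sup>2 = (norm x)\<^sup>2"
    using cinner_ell2_single[of "ell2_single g x" g x]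
    by (simp add: ell2_single.rep_eq power2_norm_eq_inner inner_eq_Re_cinner)
  then show ?thesis by simp
qed

definition coord :: "'g \<Rightarrow> ('g, 'h::chilbert_space) ell2 \<Rightarrow>\<^sub>L 'h" where
  "coord g = Blinfun (\<lambda>\<xi>. ell2_apply \<xi> g)"

definition embed :: "'g \<Rightarrow> 'h::chilbert_space \<Rightarrow>\<^sub>L ('g, 'h) ell2" where
  "embed g = Blinfun (ell2_single g)"

lemma coord_apply [simp]:
  fixes \<xi> :: "('g, 'h::chilbert_space) ell2"
  shows "coord g \<xi> = ell2_apply \<xi> g"
proof -
  have "bounded_linear (\<lambda>\<xi>::('g, 'h) ell2. ell2_apply \<xi> g)"
    by (rule bounded_linear_intro[where K = 1])
      (simp_all add: plus_ell2.rep_eq scaleR_ell2.rep_eq ell2_norm_apply_le)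
  then show ?thesis by (simp add: coord_def bounded_linear_Blinfun_apply)
qed

lemma embed_apply [simp]:
  fixes x :: "'h::chilbert_space"
  shows "embed (g::'g) x = ell2_single g x"
proof -
  have "bounded_linear (ell2_single g :: 'h \<Rightarrow> ('g, 'h) ell2)"
    by (rule bounded_linear_intro[where K = 1])
      (auto intro!: ell2_eqI simp: plus_ell2.rep_eq scaleR_ell2.rep_eq ell2_single.rep_eq
        norm_ell2_single)
  then show ?thesis by (simp add: embed_def bounded_linear_Blinfun_apply)
qed

lemma clinear_op_coord: "clinear_op (coord g)"
  by (simp add: clinear_op_def scaleC_ell2.rep_eq)

lemma clinear_op_embed: "clinear_op (embed g)"
  by (auto intro!: ell2_eqI simp: clinear_op_def scaleC_ell2.rep_eq ell2_single.rep_eq)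

lemma adj_coord: "adj (coord g) = embed g"
  by (rule adj_eqI[OF clinear_op_coord]) (simp add: cinner_ell2_single)

lemma adj_embed: "adj (embed g) = coord g"
  using adj_adj[OF clinear_op_coord] by (simp add: adj_coord)

lemma P_e_eq_coord: "P_e = coord 0"
  by (simp add: P_e_def coord_def)

lemma ell2_apply_sum: "ell2_apply (\<Sum>k\<in>F. f k) g = (\<Sum>k\<in>F. ell2_apply (f k) g)"
  by (induction F rule: infinite_finite_induct) (simp_all add: zero_ell2.rep_eq plus_ell2.rep_eq)

text \<open>
  The squared distance to the partial sum over \<open>F\<close> is the sum of \<open>\<parallel>\<xi>(g)\<parallel>\<^sup>2\<close> over the complement of
  \<open>F\<close>, the tail of a convergent series.
\<close>

lemma ell2_partial_sums_tendsto:
  fixes \<xi> :: "('g, 'h::chilbert_space) ell2"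
  shows "((\<lambda>F. \<Sum>k\<in>F. ell2_single k (ell2_apply \<xi> k)) \<longlongrightarrow> \<xi>) (finite_subsets_at_top UNIV)"
proof -
  define s where "s F = (\<Sum>k\<in>F. ell2_single k (ell2_apply \<xi> k))" for F
  have s: "ell2_apply (\<xi> - s F) g = (if g \<in> F then 0 else ell2_apply \<xi> g)" if "finite F" for F g
    using that by (simp add: s_def ell2_apply_diff ell2_apply_sum ell2_single.rep_eq if_distrib)
  let ?n = "\<lambda>g. (norm (ell2_apply \<xi> g))\<^sup>2"
  have "(norm (\<xi> - s F))\<^sup>2 = (norm \<xi>)\<^sup>2 - sum ?n F" if F: "finite F" for F
  proof -
    have "(norm (\<xi> - s F))\<^sup>2 = infsum ?n (UNIV - F)"
      unfolding ell2_norm_square by (rule infsum_cong_neutral) (auto simp: s F)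
    also have "\<dots> = infsum ?n UNIV - infsum ?n F"
      by (rule infsum_Diff) (auto simp: ell2_summable F)
    finally show ?thesis by (simp add: F ell2_norm_square)
  qed
  then have ev: "\<forall>\<^sub>F F in finite_subsets_at_top UNIV.
      sqrt ((norm \<xi>)\<^sup>2 - sum ?n F) = norm (s F - \<xi>)"
    by (intro eventually_finite_subsets_at_top_weakI)
      (metis norm_minus_commute norm_ge_zero real_sqrt_unique)
  have "(sum ?n \<longlongrightarrow> (norm \<xi>)\<^sup>2) (finite_subsets_at_top UNIV)"
    using has_sum_infsum[OF ell2_summable[of \<xi>]] by (simp add: has_sum_def ell2_norm_square)
  then have "((\<lambda>F. sqrt ((norm \<xi>)\<^sup>2 - sum ?n F)) \<longlongrightarrow> sqrt ((norm \<xi>)\<^sup>2 - (norm \<xi>)\<^sup>2))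
      (finite_subsets_at_top UNIV)"
    by (intro tendsto_intros)
  then have "((\<lambda>F. norm (s F - \<xi>)) \<longlongrightarrow> 0) (finite_subsets_at_top UNIV)"
    using ev by (simp add: filterlim_cong[OF refl refl ev])
  then show ?thesis
    unfolding s_def by (simp add: tendsto_norm_zero_iff LIM_zero_iff)
qed

definition entry ::
  "(('g, 'h::chilbert_space) ell2 \<Rightarrow>\<^sub>L ('g, 'h) ell2) \<Rightarrow> 'g \<Rightarrow> 'g \<Rightarrow> 'h \<Rightarrow>\<^sub>L 'h" where
  "entry z g h = coord g o\<^sub>L z o\<^sub>L embed h"

lemma entry_apply: "entry z g h x = ell2_apply (z (ell2_single h x)) g"
  by (simp add: entry_def)

lemma entry_add: "entry (z + w) g h = entry z g h + entry w g h"
  by (rule blinfun_eqI) (simp add: entry_apply blinfun.add_left plus_ell2.rep_eq)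

lemma entry_scaleC: "entry (scaleC_op c o\<^sub>L z) g h = scaleC_op c o\<^sub>L entry z g h"
  by (rule blinfun_eqI) (simp add: entry_apply scaleC_ell2.rep_eq)

lemma entry_adj:
  assumes "clinear_op z"
  shows "entry (adj z) g h = adj (entry z h g)"
  unfolding entry_def
  by (simp add: adj_compose assms clinear_op_compose clinear_op_coord clinear_op_embed adj_coord
      adj_embed blinfun_compose_assoc)

text \<open>
  Matrix multiplication. The sum converges in the strong topology; insert the expansion of \<open>w(\<delta>\<^sub>h \<otimes> x)\<close> into
  its values and use that \<open>z\<close> is continuous.
\<close>

lemma entry_compose_tendsto:
  "((\<lambda>F. (\<Sum>k\<in>F. entry z g k o\<^sub>L entry w k h) x) \<longlongrightarrow> entry (z o\<^sub>L w) g h x)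
     (finite_subsets_at_top UNIV)"
proof -
  have "(\<Sum>k\<in>F. entry z g k o\<^sub>L entry w k h) x
      = coord g (z (\<Sum>k\<in>F. ell2_single k (ell2_apply (w (ell2_single h x)) k)))" for F
    by (simp add: blinfun.sum_left blinfun.sum_right entry_apply ell2_apply_sum)
  moreover have "entry (z o\<^sub>L w) g h x = coord g (z (w (ell2_single h x)))"
    by (simp add: entry_apply)
  ultimately show ?thesis
    by (simp only:) (intro blinfun.tendsto tendsto_const ell2_partial_sums_tendsto)
qed

text \<open>
  In multiplicative notation \<open>g - h\<close> is \<open>gh\<inverse>\<close>, the element \<open>s\<close> for which \<open>\<lambda>(s)\<close> has a nonzero entry
  at \<open>(g, h)\<close>.
\<close>

definition matrices_over ::
  "('h::chilbert_space \<Rightarrow>\<^sub>L 'h) set \<Rightarrow> 'g::group_add set \<Rightarrow> (('g, 'h) ell2 \<Rightarrow>\<^sub>L ('g, 'h) ell2) set" where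
  "matrices_over M H =
     {z. clinear_op z \<and> (\<forall>g h. entry z g h \<in> (if g - h \<in> H then M else {0}))}"

text \<open>
  The two conditions on an entry, membership in \<open>M\<close> and vanishing off \<open>H\<close>, merge into membership in
  a strongly closed additive group \<open>E g h\<close>. All that remains of the algebra structure are the rules
  \<open>E g k \<cdot> E k h \<subseteq> E g h\<close> and \<open>(E h g)\<^sup>* \<subseteq> E g h\<close>, which is where the subgroup laws enter. The set is
  strongly closed because entries depend strongly continuously on the operator.
\<close>

lemma von_neumann_algebra_matrices_over:
  fixes M :: "('h::chilbert_space \<Rightarrow>\<^sub>L 'h) set" and H :: "'g::group_add set"
  assumes M: "von_neumann_algebra M" and H: "subgroup_add H"
  shows "von_neumann_algebra (matrices_over M H)"
proof -
  define E where "E g h = (if g - h \<in> H then M else {0})" for g h :: 'g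
  have mem: "z \<in> matrices_over M H \<longleftrightarrow> clinear_op z \<and> (\<forall>g h. entry z g h \<in> E g h)" for z
    by (simp add: matrices_over_def E_def)
  have E_compose: "x o\<^sub>L y \<in> E g h" if "x \<in> E g k" "y \<in> E k h" for x y g k h
  proof (cases "g - k \<in> H \<and> k - h \<in> H")
    case True
    then have "(g - k) + (k - h) \<in> H" using H unfolding subgroup_add_def by blast
    then have "g - h \<in> H" by (simp add: diff_add_eq_diff_diff_swap add_diff_eq)
    with True that show ?thesis by (simp add: E_def vna_compose[OF M])
  next
    case False
    then have "x o\<^sub>L y = 0" using that by (auto simp: E_def split: if_splits)
    then show ?thesis by (simp add: E_def vna_zero[OF M])
  qed
  have E_adj: "adj x \<in> E g h" if "x \<in> E h g" for x g h
  proof -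
    have "g - h \<in> H \<longleftrightarrow> h - g \<in> H"
      using H unfolding subgroup_add_def by (metis minus_diff_eq)
    moreover have "adj (0 :: 'h \<Rightarrow>\<^sub>L 'h) = 0"
      by (rule adj_eqI) (auto simp: clinear_op_def)
    ultimately show ?thesis using that by (auto simp: E_def vna_adj[OF M] split: if_splits)
  qed
  have E_sum: "(\<Sum>i\<in>I. f i) \<in> E g h" if "\<And>i. f i \<in> E g h" for f g h and I :: "'g set"
    using that by (auto simp: E_def intro!: vna_sum[OF M] sum.neutral split: if_splits)
  have E_add: "x + y \<in> E g h" if "x \<in> E g h" "y \<in> E g h" for x y g h
    using that by (auto simp: E_def vna_add[OF M] split: if_splits)
  have E_scaleC: "scaleC_op c o\<^sub>L x \<in> E g h" if "x \<in> E g h" for c x g h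
    using that by (auto simp: E_def vna_scaleC[OF M] split: if_splits)
  have E_closed: "closedin strong_operator_topology (E g h)" for g h
    by (simp add: E_def vna_closedin[OF M] closedin_strong_zero)
  show ?thesis
    unfolding von_neumann_algebra_def
  proof (intro conjI ballI allI)
    show "id_blinfun \<in> matrices_over M H"
    proof -
      have "entry id_blinfun g h = (if g = h then id_blinfun else (0 :: 'h \<Rightarrow>\<^sub>L 'h))" for g h :: 'g
        by (rule blinfun_eqI) (simp add: entry_apply ell2_single.rep_eq)
      then show ?thesis
        using H vna_id[OF M] vna_zero[OF M]
        by (auto simp: mem E_def clinear_op_id subgroup_add_def)
    qed
    show "x + y \<in> matrices_over M H" if "x \<in> matrices_over M H" "y \<in> matrices_over M H" for x y
      using that by (simp add: mem clinear_op_add entry_add E_add)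
    show "scaleC_op c o\<^sub>L x \<in> matrices_over M H" if "x \<in> matrices_over M H" for c x
      using that by (simp add: mem clinear_op_compose clinear_op_scaleC_op entry_scaleC E_scaleC)
    show "adj x \<in> matrices_over M H" if "x \<in> matrices_over M H" for x
      using that by (auto simp: mem clinear_op_adj entry_adj E_adj)
    show "z o\<^sub>L w \<in> matrices_over M H"
      if "z \<in> matrices_over M H" "w \<in> matrices_over M H" for z w
    proof -
      have "entry (z o\<^sub>L w) g h \<in> E g h" for g h
      proof (rule closedin_strong_pointwise_limit[OF E_closed _ _ entry_compose_tendsto])
        show "\<forall>\<^sub>F F in finite_subsets_at_top UNIV. (\<Sum>k\<in>F. entry z g k o\<^sub>L entry w k h) \<in> E g h"
          using that by (intro always_eventually allI E_sum E_compose) (auto simp: mem)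
      qed simp
      then show ?thesis using that by (simp add: mem clinear_op_compose)
    qed
    show "clinear_op x" if "x \<in> matrices_over M H" for x
      using that by (simp add: mem)
    have "closedin strong_operator_topology {z :: ('g, 'h) ell2 \<Rightarrow>\<^sub>L ('g, 'h) ell2. entry z g h \<in> E g h}" for g h
      using closedin_continuous_map_preimage[OF continuous_map_strong_compose E_closed[of g h]]
      by (simp add: entry_def strong_operator_topology_topspace)
    then have "closedin strong_operator_topology
        ({z :: ('g, 'h) ell2 \<Rightarrow>\<^sub>L ('g, 'h) ell2. clinear_op z} \<inter> (\<Inter>g. \<Inter>h. {z. entry z g h \<in> E g h}))"
      by (intro closedin_Int closedin_strong_clinear_op closedin_Inter) auto
    moreover have "{z. clinear_op z} \<inter> (\<Inter>g. \<Inter>h. {z. entry z g h \<in> E g h}) = matrices_over M H"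
      by (auto simp: mem)
    ultimately show "closedin strong_operator_topology (matrices_over M H)" by simp
  qed
qed


section \<open>Crossed products as algebras of matrices\<close>

text \<open>
  The uniform bound on the \<open>\<alpha>\<^sub>g(a)\<close> ensures that the defining formula yields square-summable families
  and a bounded operator, so that neither \<open>Abs_ell2\<close> nor \<open>Blinfun\<close> returns an unspecified value.
\<close>

lemma pi_rep_apply:
  fixes M :: "('h::chilbert_space \<Rightarrow>\<^sub>L 'h) set"
    and \<alpha> :: "'g::group_add \<Rightarrow> ('h \<Rightarrow>\<^sub>L 'h) \<Rightarrow> ('h \<Rightarrow>\<^sub>L 'h)"
  assumes M: "von_neumann_algebra M" and \<alpha>: "acts_by_star_automorphisms M \<alpha>" and a: "a \<in> M"
  shows "ell2_apply (pi_rep \<alpha> a \<xi>) g = \<alpha> (- g) a (ell2_apply \<xi> g)"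
proof -
  define C where "C = norm a + 1"
  define f where "f \<xi> g = \<alpha> (- g) a (ell2_apply \<xi> g)" for \<xi> :: "('g, 'h) ell2" and g
  have "norm (\<alpha> g a) \<le> C" for g
    using star_automorphism_norm_le[OF M _ a] \<alpha> by (simp add: C_def acts_by_star_automorphisms_def)
  then have "norm (f \<xi> g) \<le> C * norm (ell2_apply \<xi> g)" for \<xi> g
    unfolding f_def by (intro order_trans[OF norm_blinfun] mult_right_mono) auto
  then have f_le: "(norm (f \<xi> g))\<^sup>2 \<le> C\<^sup>2 * (norm (ell2_apply \<xi> g))\<^sup>2" for \<xi> g
    unfolding power_mult_distrib[symmetric] by (rule power_mono) simp
  have "(\<Sum>g\<in>F. (norm (f \<xi> g))\<^sup>2) \<le> (C * norm \<xi>)\<^sup>2" if "finite F" for F \<xi>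
  proof -
    have "(\<Sum>g\<in>F. (norm (f \<xi> g))\<^sup>2) \<le> C\<^sup>2 * (\<Sum>g\<in>F. (norm (ell2_apply \<xi> g))\<^sup>2)"
      unfolding sum_distrib_left by (intro sum_mono f_le)
    also have "\<dots> \<le> C\<^sup>2 * (norm \<xi>)\<^sup>2"
      by (intro mult_left_mono ell2_sum_le_norm that) simp
    finally show ?thesis by (simp add: power_mult_distrib)
  qed
  note bound = ell2_bounded_partial_sums[OF this]
  have apply_f: "ell2_apply (Abs_ell2 (f \<xi>)) = f \<xi>" for \<xi>
    using bound(1) by (simp add: Abs_ell2_inverse)
  have "bounded_linear (\<lambda>\<xi>. Abs_ell2 (f \<xi>))"
  proof (rule bounded_linear_intro[where K = C])
    fix \<xi> \<eta> :: "('g, 'h) ell2" and r :: real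
    show "Abs_ell2 (f (\<xi> + \<eta>)) = Abs_ell2 (f \<xi>) + Abs_ell2 (f \<eta>)"
      by (rule ell2_eqI) (simp add: apply_f plus_ell2.rep_eq f_def blinfun.add_right)
    show "Abs_ell2 (f (r *\<^sub>R \<xi>)) = r *\<^sub>R Abs_ell2 (f \<xi>)"
      by (rule ell2_eqI) (simp add: apply_f scaleR_ell2.rep_eq f_def blinfun.scaleR_right)
    have "(norm (Abs_ell2 (f \<xi>)))\<^sup>2 \<le> (C * norm \<xi>)\<^sup>2"
      unfolding ell2_norm_square apply_f by (rule bound(2))
    then have "norm (Abs_ell2 (f \<xi>)) \<le> C * norm \<xi>"
      by (rule power2_le_imp_le) (simp add: C_def)
    then show "norm (Abs_ell2 (f \<xi>)) \<le> norm \<xi> * C" by (simp only: mult.commute)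
  qed
  then show ?thesis
    by (simp add: pi_rep_def f_def[symmetric] bounded_linear_Blinfun_apply apply_f)
qed

lemma bij_translate: "bij_betw (\<lambda>h. - g + h) UNIV (UNIV :: 'g::group_add set)"
  by (rule bij_betw_byWitness[where f' = "\<lambda>h. g + h"]) (simp_all add: add.assoc[symmetric])

lemma
  fixes \<xi> :: "('g::group_add, 'h::chilbert_space) ell2"
  shows lambda_rep_apply: "ell2_apply (lambda_rep g \<xi>) h = ell2_apply \<xi> (- g + h)" (is ?apply)
    and norm_lambda_rep_apply: "norm (lambda_rep g \<xi>) = norm \<xi>" (is ?norm)
proof -
  define f where "f \<xi> h = ell2_apply \<xi> (- g + h)" for \<xi> :: "('g, 'h) ell2" and h
  have apply_f: "ell2_apply (Abs_ell2 (f \<xi>)) = f \<xi>" for \<xi>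
    using summable_on_reindex_bij_betw[OF bij_translate[of g], of "\<lambda>h. (norm (ell2_apply \<xi> h))\<^sup>2"]
      ell2_summable[of \<xi>]
    by (simp add: Abs_ell2_inverse f_def)
  have "(norm (Abs_ell2 (f \<xi>)))\<^sup>2 = (norm \<xi>)\<^sup>2" for \<xi>
    unfolding ell2_norm_square apply_f f_def
    by (rule infsum_reindex_bij_betw[OF bij_translate])
  then have norm_f: "norm (Abs_ell2 (f \<xi>)) = norm \<xi>" for \<xi>
    by (simp add: power2_eq_iff_nonneg)
  have "bounded_linear (\<lambda>\<xi>. Abs_ell2 (f \<xi>))"
  proof (rule bounded_linear_intro[where K = 1])
    fix \<xi> \<eta> :: "('g, 'h) ell2" and r :: real
    show "Abs_ell2 (f (\<xi> + \<eta>)) = Abs_ell2 (f \<xi>) + Abs_ell2 (f \<eta>)"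
      by (rule ell2_eqI) (simp add: apply_f plus_ell2.rep_eq f_def)
    show "Abs_ell2 (f (r *\<^sub>R \<xi>)) = r *\<^sub>R Abs_ell2 (f \<xi>)"
      by (rule ell2_eqI) (simp add: apply_f scaleR_ell2.rep_eq f_def)
  qed (simp add: norm_f)
  then have "lambda_rep g \<xi> = Abs_ell2 (f \<xi>)"
    by (simp add: lambda_rep_def f_def[symmetric] bounded_linear_Blinfun_apply)
  then show ?apply ?norm
    by (simp_all add: apply_f norm_f) (simp add: f_def)
qed

lemma lambda_rep_single: "lambda_rep g (ell2_single h x) = ell2_single (g + h) x"
proof (rule ell2_eqI)
  fix k
  have "- g + k = h \<longleftrightarrow> k = g + h"
    by (metis add_minus_cancel minus_add_cancel)
  then show "ell2_apply (lambda_rep g (ell2_single h x)) k = ell2_apply (ell2_single (g + h) x) k"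
    by (simp add: lambda_rep_apply ell2_single.rep_eq)
qed

lemma norm_lambda_rep_le: "norm (lambda_rep g) \<le> 1"
  by (rule norm_blinfun_bound) (simp_all add: norm_lambda_rep_apply)

lemma pi_rep_in_matrices_over:
  assumes M: "von_neumann_algebra M" and \<alpha>: "acts_by_star_automorphisms M \<alpha>"
    and H: "subgroup_add H" and a: "a \<in> M"
  shows "pi_rep \<alpha> a \<in> matrices_over M H"
proof -
  have in_M: "\<alpha> g a \<in> M" for g
    using star_automorphism_in[OF M _ a] \<alpha> by (simp add: acts_by_star_automorphisms_def)
  have "clinear_op (pi_rep \<alpha> a)"
    using vna_clinear[OF M in_M]
    by (auto intro!: ell2_eqI simp: clinear_op_def scaleC_ell2.rep_eq pi_rep_apply[OF M \<alpha> a])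
  moreover have "entry (pi_rep \<alpha> a) g h = (if g = h then \<alpha> (- g) a else 0)" for g h
    by (rule blinfun_eqI) (simp add: entry_apply pi_rep_apply[OF M \<alpha> a] ell2_single.rep_eq)
  ultimately show ?thesis
    using H in_M vna_zero[OF M] by (auto simp: matrices_over_def subgroup_add_def)
qed

lemma lambda_rep_in_matrices_over:
  fixes M :: "('h::chilbert_space \<Rightarrow>\<^sub>L 'h) set"
  assumes M: "von_neumann_algebra M" and g: "g \<in> H"
  shows "lambda_rep g \<in> matrices_over M H"
proof -
  have "clinear_op (lambda_rep g :: ('a, 'h) ell2 \<Rightarrow>\<^sub>L ('a, 'h) ell2)"
    by (auto intro!: ell2_eqI simp: clinear_op_def scaleC_ell2.rep_eq lambda_rep_apply)
  moreover have "entry (lambda_rep g) k h = (if k = g + h then id_blinfun else (0 :: 'h \<Rightarrow>\<^sub>L 'h))" for k h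
    by (rule blinfun_eqI) (simp add: entry_apply lambda_rep_single ell2_single.rep_eq)
  ultimately show ?thesis
    using g vna_zero[OF M] vna_id[OF M] by (auto simp: matrices_over_def)
qed

lemma crossed_product_subset_matrices_over:
  assumes "von_neumann_algebra M" and "acts_by_star_automorphisms M \<alpha>" and "subgroup_add H"
  shows "crossed_product M \<alpha> H \<subseteq> matrices_over M H"
  unfolding crossed_product_def vna_generated_def
  using von_neumann_algebra_matrices_over pi_rep_in_matrices_over lambda_rep_in_matrices_over assms
  by (intro Inter_lower) blast

lemma zero_in_crossed_product: "0 \<in> crossed_product M \<alpha> H"
  by (auto simp: crossed_product_def vna_generated_def intro: vna_zero)

lemma lambda_rep_in_crossed_product: "g \<in> H \<Longrightarrow> lambda_rep g \<in> crossed_product M \<alpha> H"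
  by (auto simp: crossed_product_def vna_generated_def)

lemma matrices_over_mono:
  assumes "von_neumann_algebra M" and "H \<subseteq> K"
  shows "matrices_over M H \<subseteq> matrices_over M K"
  using assms(2) vna_zero[OF assms(1)]
  by (fastforce simp: matrices_over_def split: if_splits)

lemma subgroup_add_UNIV: "subgroup_add UNIV"
  by (simp add: subgroup_add_def)


section \<open>The trace norm and the Mashood--Taylor distance\<close>

lemma state_on_mono:
  assumes "von_neumann_algebra M" and "state_on M \<tau>" and "x \<in> M" "y \<in> M" and "op_le x y"
  shows "Re (\<tau> x) \<le> Re (\<tau> y)"
proof -
  have d: "y - x \<in> M" by (rule vna_diff) fact+
  have "\<tau> ((y - x) + x) = \<tau> (y - x) + \<tau> x"
    using assms(2,3) d by (simp only: state_on_def)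
  moreover have "\<tau> (y - x) \<in> \<real>\<^sub>\<ge>\<^sub>0"
    using assms(2,5) d by (simp add: state_on_def op_le_def)
  ultimately show ?thesis by (auto simp: complex_nonneg_Reals_iff)
qed

context
  fixes M :: "('h::chilbert_space \<Rightarrow>\<^sub>L 'h) set" and \<tau> :: "('h \<Rightarrow>\<^sub>L 'h) \<Rightarrow> complex"
    and z :: "('g::group_add, 'h) ell2 \<Rightarrow>\<^sub>L ('g, 'h) ell2"
  assumes M: "von_neumann_algebra M" and \<tau>: "state_on M \<tau>"
    and z: "z \<in> matrices_over M UNIV"
begin

text \<open>
  The first part matters because \<open>\<tau>\<close> is controlled on \<open>M\<close> only; the last part reduces comparisons of
  \<open>E(z\<^sup>*z)\<close> with \<open>1\<close> to comparisons of vector norms.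
\<close>

lemma cond_exp_square:
  "cond_exp (adj z o\<^sub>L z) \<in> M" "clinear_op (cond_exp (adj z o\<^sub>L z))"
  "cinner (cond_exp (adj z o\<^sub>L z) x) x = complex_of_real ((norm (z (ell2_single 0 x)))\<^sup>2)"
proof -
  have cz: "clinear_op z" using z by (simp add: matrices_over_def)
  have eq: "cond_exp w = entry w 0 0" for w :: "('g, 'h) ell2 \<Rightarrow>\<^sub>L ('g, 'h) ell2"
    by (simp add: cond_exp_def entry_def P_e_eq_coord adj_coord)
  have N: "von_neumann_algebra (matrices_over M (UNIV :: 'g set))"
    by (rule von_neumann_algebra_matrices_over[OF M subgroup_add_UNIV])
  have "adj z o\<^sub>L z \<in> matrices_over M UNIV"
    by (intro vna_compose[OF N] vna_adj[OF N] z)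
  then show mem: "cond_exp (adj z o\<^sub>L z) \<in> M"
    by (simp add: eq matrices_over_def)
  then show "clinear_op (cond_exp (adj z o\<^sub>L z))" by (rule vna_clinear[OF M])
  show "cinner (cond_exp (adj z o\<^sub>L z) x) x = complex_of_real ((norm (z (ell2_single 0 x)))\<^sup>2)"
    using cinner_adj_compose_self[OF cz, of "ell2_single 0 x"]
    by (simp add: eq entry_apply cinner_ell2_single)
qed

lemma trace_norm_canonical_nonneg: "0 \<le> trace_norm (canonical_trace \<tau>) z"
proof -
  have "positive_op (cond_exp (adj z o\<^sub>L z))"
    by (simp add: positive_op_def cond_exp_square)
  then have "\<tau> (cond_exp (adj z o\<^sub>L z)) \<in> \<real>\<^sub>\<ge>\<^sub>0"
    using \<tau> by (simp add: state_on_def cond_exp_square)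
  then show ?thesis
    by (simp add: trace_norm_def canonical_trace_def complex_nonneg_Reals_iff)
qed

lemma trace_norm_canonical_le_1:
  assumes "\<And>x. norm (z (ell2_single 0 x)) \<le> norm x"
  shows "trace_norm (canonical_trace \<tau>) z \<le> 1"
proof -
  have "op_le (cond_exp (adj z o\<^sub>L z)) id_blinfun"
    using assms
    by (auto simp: op_le_def positive_op_def clinear_op_diff clinear_op_id cond_exp_square
        blinfun.diff_left cinner_diff_left cinner_self complex_nonneg_Reals_iff
        power_mono simp flip: power2_norm_eq_inner)
  from state_on_mono[OF M \<tau> cond_exp_square(1) vna_id[OF M] this]
  show ?thesis using \<tau> by (simp add: trace_norm_def canonical_trace_def state_on_def)
qed

lemma trace_norm_canonical_ge_1:
  assumes "\<And>x. norm x \<le> norm (z (ell2_single 0 x))"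
  shows "1 \<le> trace_norm (canonical_trace \<tau>) z"
proof -
  have "op_le id_blinfun (cond_exp (adj z o\<^sub>L z))"
    using assms
    by (auto simp: op_le_def positive_op_def clinear_op_diff clinear_op_id cond_exp_square
        blinfun.diff_left cinner_diff_left cinner_self complex_nonneg_Reals_iff
        power_mono simp flip: power2_norm_eq_inner)
  from state_on_mono[OF M \<tau> vna_id[OF M] cond_exp_square(1) this]
  show ?thesis using \<tau> by (simp add: trace_norm_def canonical_trace_def state_on_def)
qed

end

text \<open>
  The vectors \<open>\<lambda>(g)(\<delta>\<^sub>e \<otimes> x) = \<delta>\<^sub>g \<otimes> x\<close> and \<open>y(\<delta>\<^sub>e \<otimes> x)\<close> are orthogonal, since the second one
  vanishes at \<open>g\<close>; so subtracting it cannot decrease the norm.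
\<close>

lemma norm_le_lambda_rep_diff:
  assumes y: "y \<in> matrices_over M K" and g: "g \<notin> K"
  shows "norm x \<le> norm ((lambda_rep g - y) (ell2_single 0 x))"
proof -
  let ?e = "ell2_single g x" and ?w = "y (ell2_single 0 x)"
  have "entry y g 0 \<in> (if g - 0 \<in> K then M else {0})"
    using y unfolding matrices_over_def by blast
  then have "entry y g 0 = 0" using g by simp
  then have "ell2_apply ?w g = 0"
    by (simp flip: entry_apply)
  then have "inner ?w ?e = 0"
    by (simp add: inner_eq_Re_cinner cinner_ell2_single)
  then have "(norm (?e - ?w))\<^sup>2 = (norm x)\<^sup>2 + (norm ?w)\<^sup>2"
    using dot_norm_neg[of ?w ?e] by (simp add: norm_ell2_single norm_minus_commute)
  then have "(norm x)\<^sup>2 \<le> (norm (?e - ?w))\<^sup>2" by simp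
  then have "norm x \<le> norm (?e - ?w)" by (rule power2_le_imp_le) simp
  then show ?thesis by (simp add: blinfun.diff_left lambda_rep_single)
qed

text \<open>
  A common point \<open>p\<close> at distance at most \<open>r\<close> from everything bounds both suprema by \<open>r\<close>, and one point
  at distance at least \<open>r\<close> from the whole other set shows that the bound is attained. Nonnegativity
  of \<open>d\<close> keeps the sets under the infima bounded below; otherwise the infima would be unspecified.
\<close>

lemma hausdorff_distance_eqI:
  fixes d :: "'a \<Rightarrow> 'a \<Rightarrow> real"
  assumes p: "p \<in> A" "p \<in> B"
    and nonneg: "\<And>a b. a \<in> A \<Longrightarrow> b \<in> B \<Longrightarrow> 0 \<le> d a b"
    and le: "\<And>a. a \<in> A \<Longrightarrow> d a p \<le> r" "\<And>b. b \<in> B \<Longrightarrow> d p b \<le> r"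
    and far: "(\<exists>a\<in>A. \<forall>b\<in>B. r \<le> d a b) \<or> (\<exists>b\<in>B. \<forall>a\<in>A. r \<le> d a b)"
  shows "hausdorff_distance d A B = r"
proof -
  have INF_A: "(INF b\<in>B. d a b) \<le> r" if "a \<in> A" for a
    using that by (intro cINF_lower2[of _ _ p] bdd_belowI2[where m = 0] p le nonneg)
  have INF_B: "(INF a\<in>A. d a b) \<le> r" if "b \<in> B" for b
    using that by (intro cINF_lower2[of _ _ p] bdd_belowI2[where m = 0] p le nonneg)
  have SUP_A: "(SUP a\<in>A. INF b\<in>B. d a b) \<le> r" and SUP_B: "(SUP b\<in>B. INF a\<in>A. d a b) \<le> r"
    using p by (auto intro!: cSUP_least INF_A INF_B)
  from far show ?thesis
  proof
    assume "\<exists>a\<in>A. \<forall>b\<in>B. r \<le> d a b"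
    then obtain a where a: "a \<in> A" "\<And>b. b \<in> B \<Longrightarrow> r \<le> d a b" by blast
    have "r \<le> (INF b\<in>B. d a b)" using p a by (intro cINF_greatest) auto
    also have "\<dots> \<le> (SUP a\<in>A. INF b\<in>B. d a b)"
      by (intro cSUP_upper a bdd_aboveI2[where M = r] INF_A)
    finally show ?thesis using SUP_A SUP_B by (simp add: hausdorff_distance_def)
  next
    assume "\<exists>b\<in>B. \<forall>a\<in>A. r \<le> d a b"
    then obtain b where b: "b \<in> B" "\<And>a. a \<in> A \<Longrightarrow> r \<le> d a b" by blast
    have "r \<le> (INF a\<in>A. d a b)" using p b by (intro cINF_greatest) auto
    also have "\<dots> \<le> (SUP b\<in>B. INF a\<in>A. d a b)"
      by (intro cSUP_upper b bdd_aboveI2[where M = r] INF_B)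
    finally show ?thesis using SUP_A SUP_B by (simp add: hausdorff_distance_def)
  qed
qed

theorem theorem5p11:
  fixes M :: "('h::chilbert_space \<Rightarrow>\<^sub>L 'h) set"
    and \<alpha> :: "'g::group_add \<Rightarrow> ('h \<Rightarrow>\<^sub>L 'h) \<Rightarrow> ('h \<Rightarrow>\<^sub>L 'h)"
    and \<tau> :: "('h \<Rightarrow>\<^sub>L 'h) \<Rightarrow> complex"
    and H K :: "'g set"
  assumes "finite_von_neumann_algebra M"
    and "acts_by_star_automorphisms M \<alpha>"
    and "faithful_normal_tracial_state M \<tau>"
    and "\<And>g x. x \<in> M \<Longrightarrow> \<tau> (\<alpha> g x) = \<tau> x"
    and "subgroup_add H" and "subgroup_add K" and "H \<noteq> K"
  shows "mashood_taylor_distance (canonical_trace \<tau>)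
           (crossed_product M \<alpha> H) (crossed_product M \<alpha> K) = 1"
proof -
  let ?A = "op_unit_ball (crossed_product M \<alpha> H)" and ?B = "op_unit_ball (crossed_product M \<alpha> K)"
  let ?d = "\<lambda>x y :: ('g, 'h) ell2 \<Rightarrow>\<^sub>L ('g, 'h) ell2. trace_norm (canonical_trace \<tau>) (x - y)"
  have M: "von_neumann_algebra M"
    using assms(1) by (simp add: finite_von_neumann_algebra_def)
  have \<tau>: "state_on M \<tau>"
    using assms(3) by (simp add: faithful_normal_tracial_state_def)
  have A: "x \<in> matrices_over M H" and B: "y \<in> matrices_over M K"
    if "x \<in> ?A" "y \<in> ?B" for x y
    using that crossed_product_subset_matrices_over[OF M assms(2)] assms(5,6)
    by (auto simp: op_unit_ball_def)
  have diff: "x - y \<in> matrices_over M UNIV" if "x \<in> ?A" "y \<in> ?B" for x y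
    using vna_diff[OF von_neumann_algebra_matrices_over[OF M subgroup_add_UNIV]]
      A[OF that] B[OF that] matrices_over_mono[OF M subset_UNIV] by blast
  have zero: "0 \<in> ?A" "0 \<in> ?B"
    by (simp_all add: op_unit_ball_def zero_in_crossed_product)
  have lambda: "lambda_rep g \<in> op_unit_ball (crossed_product M \<alpha> L)" if "g \<in> L" for g L
    using that by (simp add: op_unit_ball_def lambda_rep_in_crossed_product norm_lambda_rep_le)
  have contraction: "norm (x (ell2_single 0 v)) \<le> norm v"
    if "norm x \<le> 1" for x :: "('g, 'h) ell2 \<Rightarrow>\<^sub>L ('g, 'h) ell2" and v
    using norm_blinfun[of x "ell2_single 0 v"] mult_right_mono[OF that norm_ge_zero[of v]]
    by (simp add: norm_ell2_single)
  show ?thesis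
    unfolding mashood_taylor_distance_def
  proof (rule hausdorff_distance_eqI[OF zero])
    show "0 \<le> ?d x y" if "x \<in> ?A" "y \<in> ?B" for x y
      by (rule trace_norm_canonical_nonneg[OF M \<tau> diff[OF that]])
    show "?d x 0 \<le> 1" if "x \<in> ?A" for x
      using that contraction
      by (intro trace_norm_canonical_le_1[OF M \<tau> diff] zero) (simp_all add: op_unit_ball_def)
    show "?d 0 y \<le> 1" if "y \<in> ?B" for y
      using that contraction
      by (intro trace_norm_canonical_le_1[OF M \<tau> diff] zero)
        (simp_all add: op_unit_ball_def blinfun.minus_left)
    from \<open>H \<noteq> K\<close> consider g where "g \<in> H" "g \<notin> K" | g where "g \<in> K" "g \<notin> H"
      by blast
    then show "(\<exists>x\<in>?A. \<forall>y\<in>?B. 1 \<le> ?d x y) \<or> (\<exists>y\<in>?B. \<forall>x\<in>?A. 1 \<le> ?d x y)"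
    proof cases
      case 1
      have "1 \<le> ?d (lambda_rep g) y" if "y \<in> ?B" for y
        by (intro trace_norm_canonical_ge_1[OF M \<tau> diff] lambda that
            norm_le_lambda_rep_diff[OF B[OF zero(1)]] 1)
      then show ?thesis using lambda[OF 1(1)] by blast
    next
      case 2
      have "1 \<le> ?d x (lambda_rep g)" if "x \<in> ?A" for x
      proof (intro trace_norm_canonical_ge_1[OF M \<tau> diff] lambda that 2)
        show "norm v \<le> norm ((x - lambda_rep g) (ell2_single 0 v))" for v
          using norm_le_lambda_rep_diff[OF A[OF that zero(2)] 2(2)]
          by (simp add: blinfun.diff_left norm_minus_commute)
      qed
      then show ?thesis using lambda[OF 2(1)] by blast
    qed
  qed
qed

end
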